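(* Let $f_1,\dots,f_M:\mathbb{R}^d\to\mathbb{R}$ be differentiable (possibly nonconvex) functions such that each $\nabla f_i$ is $L$-Lipschitz and there is $D>0$ with $\|\nabla f_i(x)\|\le D$ for all $x\in\mathbb{R}^d$ and $i\in[M]=\{1,\dots,M\}$. Let $f=\frac1M\sum_{i=1}^M f_i$, and assume $f$ attains its minimum over $\mathbb{R}^d$. Let $(j_k)_{k\ge0}$ be a time-homogeneous, irreducible, aperiodic Markov chain on $[M]$ with transition matrix $P$ and uniform stationary distribution $(\frac1M,\dots,\frac1M)$. Let $(\gamma_k)_{k\ge0}$ be positive stepsizes satisfying $$\sum_k\gamma_k=+\infty,\qquad \sum_{k\ge1}\ln^2 k\cdot\gamma_k^2<+\infty .$$ Let $x^0\in\mathbb{R}^d$ be deterministic and arbitrary, and let $(x^k)_{k\ge0}$ be generated by $x^{k+1}=x^k-\gamma_k\nabla f_{j_k}(x^k)$. Then: (1) $\lim_k\mathbb{E}\|\nabla f(x^k)\|=0$. (2) $\mathbb{E}\big(\min_{1\le i\le k}\|\nabla f(x^i)\|^2\big)=O\Big(\frac{\psi(P)}{\sum_{i=1}^k\gamma_i}\Big)$. (3) If $\gamma_k=\Theta(k^{-q})$ with $\frac12<q<1$, then $\mathbb{E}\big(\min_{1\le i\le k}\|\nabla f(x^i)\|^2\big)=O\big(\frac{\psi(P)}{k^{1-q}}\big)$. Furthermore, let $(e^k)_{k\ge0}$ be a sequence of noise in $\mathbb{R}^d$ and consider instead the inexact iteration $x^{k+1}=x^k-\gamma_k(\nabla f_{j_k}(x^k)+e^k)$.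 If $\sum_{k=1}^\infty\gamma_k\|e^k\|<+\infty$, then (1) and (2) still hold for the sequence generated by the inexact iteration. In addition, if $\gamma_k=\Theta(k^{-q})$ with $\frac12<q<1$ and $\|e^k\|=O(k^{-p})$ with $p+q>1$, then for the inexact iteration (1) still holds and $\mathbb{E}\big(\min_{1\le i\le k}\|\nabla f(x^i)\|^2\big)=O\big(\frac{\psi(P)}{k^{1-q}}\big)$.
   Context: The initial distribution of the Markov chain is arbitrary; expectations are over the trajectory $(j_k)$. The noise $(e^k)$ is deterministic. Let $\lambda_1(P)=1,\lambda_2(P),\dots,\lambda_M(P)\in\mathbb{C}$ be the eigenvalues of $P$, ordered by decreasing modulus. Define $$\lambda(P):=\frac{\max\{|\lambda_2(P)|,|\lambda_M(P)|\}+1}{2}\in[0,1),\qquad \psi(P):=\max\Big\{1,\frac{1}{\ln(1/\lambda(P))}\Big\}.$$ $O(\cdot)$ and $\Theta(\cdot)$ are as $k\to\infty$, with implied constants not depending on $k$. *)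

theory Defs
  imports
    "HOL-Probability.Probability"
    "HOL-Library.Landau_Symbols"
    "Jordan_Normal_Form.Char_Poly"
begin

definition grad :: "('a::real_inner \<Rightarrow> real) \<Rightarrow> 'a \<Rightarrow> 'a" where
  "grad f x = (THE D. GDERIV f x :> D)"

text \<open>
  The definite description is harmless: a differentiable function on a Euclidean space has
  exactly one gradient at each point.
\<close>

lemma GDERIV_grad:
  fixes f :: "'a::euclidean_space \<Rightarrow> real"
  assumes "f differentiable (at x)"
  shows "GDERIV f x :> grad f x"
proof -
  obtain f' where f': "(f has_derivative f') (at x)"
    using assms by (auto simp: differentiable_def)
  define D where "D = (\<Sum>b\<in>Basis. f' b *\<^sub>R b)"
  interpret linear f' using f' by (rule has_derivative_linear)
  have "f' h = inner h D" for h
  proof -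
    have "f' h = f' (\<Sum>b\<in>Basis. inner h b *\<^sub>R b)" by (simp add: euclidean_representation)
    also have "\<dots> = (\<Sum>b\<in>Basis. inner h b * f' b)" by (simp add: sum scale)
    also have "\<dots> = inner h D"
      by (simp add: D_def inner_sum_right mult.commute)
    finally show ?thesis .
  qed
  hence "f' = (\<lambda>h. inner h D)" by (rule ext)
  with f' have ex: "GDERIV f x :> D" by (simp add: gderiv_def)
  have "D' = D" if "GDERIV f x :> D'" for D'
  proof -
    have "(\<lambda>h. inner h D') = (\<lambda>h. inner h D)"
      using that ex unfolding gderiv_def by (rule has_derivative_unique)
    hence "inner (D' - D) D' = inner (D' - D) D" by (rule fun_cong)
    thus ?thesis by (metis inner_eq_zero_iff inner_diff_right right_minus_eq)
  qed
  with ex show ?thesis unfolding grad_def by (rule theI)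
qed

text \<open>States are the matrix indices $0, \dots, M-1$, where $M$ is the dimension of the
  transition matrix.\<close>

definition stochastic_matrix :: "real mat \<Rightarrow> bool" where
  "stochastic_matrix P \<longleftrightarrow> square_mat P \<and>
     (\<forall>i<dim_row P. (\<forall>j<dim_row P. 0 \<le> P $$ (i, j)) \<and> (\<Sum>j<dim_row P. P $$ (i, j)) = 1)"

definition irreducible_matrix :: "real mat \<Rightarrow> bool" where
  "irreducible_matrix P \<longleftrightarrow>
     (\<forall>i<dim_row P. \<forall>j<dim_row P. \<exists>n. (P ^\<^sub>m n) $$ (i, j) > 0)"

definition period :: "real mat \<Rightarrow> nat \<Rightarrow> nat" where
  "period P i = Gcd {n. 0 < n \<and> (P ^\<^sub>m n) $$ (i, i) > 0}"

definition aperiodic_matrix :: "real mat \<Rightarrow> bool" where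
  "aperiodic_matrix P \<longleftrightarrow> (\<forall>i<dim_row P. period P i = 1)"

definition stationary_distribution :: "real mat \<Rightarrow> (nat \<Rightarrow> real) \<Rightarrow> bool" where
  "stationary_distribution P p \<longleftrightarrow>
     (\<forall>i<dim_row P. 0 \<le> p i) \<and> (\<Sum>i<dim_row P. p i) = 1 \<and>
     (\<forall>j<dim_row P. (\<Sum>i<dim_row P. p i * P $$ (i, j)) = p j)"

text \<open>The distribution of the initial state is left unconstrained.\<close>

definition homogeneous_markov_chain ::
    "'w measure \<Rightarrow> real mat \<Rightarrow> (nat \<Rightarrow> 'w \<Rightarrow> nat) \<Rightarrow> bool" where
  "homogeneous_markov_chain S P X \<longleftrightarrow>
     prob_space S \<and> stochastic_matrix P \<and>
     (\<forall>k. X k \<in> measurable S (count_space {..<dim_row P})) \<and>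
     (\<forall>k s b. (\<forall>i\<le>k. s i < dim_row P) \<longrightarrow> b < dim_row P \<longrightarrow>
        \<P>(\<omega> in S. \<forall>i\<le>k. X i \<omega> = s i) > 0 \<longrightarrow>
        \<P>(\<omega> in S. X (Suc k) \<omega> = b \<bar> \<forall>i\<le>k. X i \<omega> = s i) = P $$ (s k, b))"

text \<open>
  The complex eigenvalues with algebraic multiplicity, by decreasing modulus. The choice only
  affects the order among eigenvalues of equal modulus. Lists are indexed from 0, so
  the eigenvalue $\lambda_i$ is entry $i - 1$.
\<close>

definition eigenvalue_list :: "real mat \<Rightarrow> complex list" where
  "eigenvalue_list P = (SOME as.
     char_poly (map_mat complex_of_real P) = (\<Prod>a\<leftarrow>as. [:- a, 1:]) \<and>
     sorted_wrt (\<lambda>a b. cmod a \<ge> cmod b) as)"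

definition eigval :: "real mat \<Rightarrow> nat \<Rightarrow> complex" where
  "eigval P i = eigenvalue_list P ! (i - 1)"

text \<open>For a single state there is no second eigenvalue; the maximum is then read as 0.\<close>

definition lambda_mat :: "real mat \<Rightarrow> real" where
  "lambda_mat P =
     ((if dim_row P \<ge> 2 then max (cmod (eigval P 2)) (cmod (eigval P (dim_row P))) else 0) + 1) / 2"

definition psi :: "real mat \<Rightarrow> real" where
  "psi P = max 1 (1 / ln (1 / lambda_mat P))"

definition mcgd :: "'w measure \<Rightarrow> (nat \<Rightarrow> 'a::real_inner \<Rightarrow> real) \<Rightarrow> (nat \<Rightarrow> real) \<Rightarrow>
    (nat \<Rightarrow> 'w \<Rightarrow> nat) \<Rightarrow> 'a \<Rightarrow> (nat \<Rightarrow> 'w \<Rightarrow> 'a) \<Rightarrow> bool" where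
  "mcgd S f \<gamma> j x0 x \<longleftrightarrow> (\<forall>\<omega>\<in>space S. x 0 \<omega> = x0 \<and>
     (\<forall>k. x (Suc k) \<omega> = x k \<omega> - \<gamma> k *\<^sub>R grad (f (j k \<omega>)) (x k \<omega>)))"

definition inexact_mcgd :: "'w measure \<Rightarrow> (nat \<Rightarrow> 'a::real_inner \<Rightarrow> real) \<Rightarrow> (nat \<Rightarrow> real) \<Rightarrow>
    (nat \<Rightarrow> 'w \<Rightarrow> nat) \<Rightarrow> (nat \<Rightarrow> 'a) \<Rightarrow> 'a \<Rightarrow> (nat \<Rightarrow> 'w \<Rightarrow> 'a) \<Rightarrow> bool" where
  "inexact_mcgd S f \<gamma> j e x0 x \<longleftrightarrow> (\<forall>\<omega>\<in>space S. x 0 \<omega> = x0 \<and>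
     (\<forall>k. x (Suc k) \<omega> = x k \<omega> - \<gamma> k *\<^sub>R (grad (f (j k \<omega>)) (x k \<omega>) + e k)))"

end

theory Submission
  imports Defs
begin

text \<open>
  The exact iteration is the inexact one with zero noise, and everything follows from
  $\sum_k \gamma_k \mathbb{E}\|\nabla F(y^k)\|^2 < \infty$. To get this, evaluate $\nabla f_{j_k}$ at the
  iterate $y^a$ with $a = k - O(\ln k)$: since $P^n$ converges geometrically to the uniform matrix, the
  conditional bias of $\nabla f_{j_k}(y^a)$ is $O(1/k)$, while replacing $y^k$ by $y^a$ costs
  $\gamma_k \sum_{a \le i < k} (D\gamma_i + \gamma_i\|e^i\|)$, which is summable because of the
  $\ln^2 k$ weight in the stepsize condition. The factor $\psi(P) \ge 1$ is constant in $k$ and is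
  absorbed by the implied constants.
\<close>

subsection \<open>Powers of a primitive matrix\<close>

text \<open>The obstacle is that \<open>j k\<close> is correlated with \<open>y k\<close>: the
  sampled gradient is a biased estimate of \<open>grad F\<close>, and a single step need not
  decrease \<open>F\<close> in expectation. The gap k - a pulls in two directions, since the bias
  decays geometrically in it while the drift of the iterate grows with it. A logarithmic gap keeps
  both errors summable after multiplication by \<gamma>; a bias of order 1/k suffices because it is
  square summable, like \<gamma> itself.

  The weighted summability yields the rates, because a minimum is at most any weighted average. For
  the limit it is not enough, as it forces smallness only along a subsequence; the missing
  ingredient is that consecutive expected gradient norms differ by a multiple of the step length.

  Starting point, stepsizes and noise are deterministic, so an iterate is a function of finitely
  many states. Every expectation is therefore a finite sum over state histories, and conditioning
  becomes splitting such sums; no regularity of the gradients is needed for integrability.\<close>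

lemma additive_set_contains_consecutive:
  fixes A :: "nat set"
  assumes add: "\<And>a b. a \<in> A \<Longrightarrow> b \<in> A \<Longrightarrow> a + b \<in> A" and zero: "0 \<in> A" and gcd: "Gcd A = 1"
  obtains a where "a \<in> A" "Suc a \<in> A"
proof -
  have mult: "q * a \<in> A" if "a \<in> A" for a q :: nat
    by (induction q) (use add zero that in auto)
  define Q where "Q d \<longleftrightarrow> d > 0 \<and> (\<exists>a\<in>A. a + d \<in> A)" for d
  have "\<exists>a\<in>A. a > 0"
  proof (rule ccontr)
    assume "\<not> ?thesis"
    hence "A \<subseteq> {0}" by auto
    hence "Gcd A = 0" by (simp add: Gcd_0_iff)
    with gcd show False by simp
  qed
  then obtain a1 where "a1 \<in> A" "a1 > 0" by blast
  hence "Q a1" using zero unfolding Q_def by (metis add_0)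
  \<comment> \<open>The least positive difference between two elements. If it failed to divide some
    a, the elements q(c + d) and qc + a would differ by the smaller positive number a mod d. Hence
    it divides the gcd and equals 1.\<close>
  define d where "d = (LEAST d. Q d)"
  have Qd: "Q d" unfolding d_def using \<open>Q a1\<close> by (rule LeastI)
  have least: "d \<le> d'" if "Q d'" for d' unfolding d_def using that by (rule Least_le)
  obtain c where c: "c \<in> A" "c + d \<in> A" "d > 0" using Qd by (auto simp: Q_def)
  have "d dvd a" if a: "a \<in> A" for a
  proof (rule ccontr)
    assume "\<not> d dvd a"
    hence r: "a mod d > 0" by (simp add: mod_greater_zero_iff_not_dvd)
    let ?q = "a div d"
    have "?q * (c + d) \<in> A" using c mult by blast
    moreover have "?q * c + a \<in> A" using c mult add a by blast
    moreover have "?q * c + a = ?q * (c + d) + a mod d"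
      by (simp add: algebra_simps)
    ultimately have "Q (a mod d)" using r unfolding Q_def by metis
    hence "d \<le> a mod d" by (rule least)
    thus False using c(3) by (meson mod_less_divisor not_le)
  qed
  hence "d dvd Gcd A" by (rule Gcd_greatest)
  hence "d = 1" using gcd by simp
  thus ?thesis using that c by simp
qed

text \<open>With consecutive elements a and a + 1 at hand, n = qa + r equals (q - r)a + r(a + 1),
  which is admissible once r < a \<le> q, that is for n at least a * a. Zero is adjoined to allow
  empty multiples; this leaves the gcd unchanged and explains the restriction to n > 0.\<close>

lemma additive_set_eventually_everything:
  fixes A :: "nat set"
  assumes add: "\<And>a b. a \<in> A \<Longrightarrow> b \<in> A \<Longrightarrow> a + b \<in> A" and gcd: "Gcd A = 1"
  obtains N where "\<And>n. n \<ge> N \<Longrightarrow> n > 0 \<Longrightarrow> n \<in> A"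
proof -
  let ?B = "insert 0 A"
  have addB: "a + b \<in> ?B" if "a \<in> ?B" "b \<in> ?B" for a b using that add by auto
  have "Gcd ?B = 1" using gcd by simp
  then obtain a where a: "a \<in> ?B" "Suc a \<in> ?B"
    using additive_set_contains_consecutive[of ?B] addB by blast
  have mult: "q * b \<in> ?B" if "b \<in> ?B" for b q :: nat
    by (induction q) (use addB that in auto)
  have "n \<in> A" if n: "n \<ge> a * a" "n > 0" for n
  proof (cases "a = 0")
    case True
    then show ?thesis using mult[OF a(2), of n] n by simp
  next
    case False
    define q r where "q = n div a" and "r = n mod a"
    have "a * a div a \<le> n div a" using n(1) by (rule div_le_mono)
    hence "a \<le> q" using False by (simp add: q_def)
    moreover have "r < a" using False by (simp add: r_def)
    ultimately have "r \<le> q" by simp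
    have "n = q * a + r" by (simp add: q_def r_def)
    also have "\<dots> = (q - r) * a + r * Suc a" using \<open>r \<le> q\<close>
      by (simp add: algebra_simps diff_mult_distrib2)
    finally have "n \<in> ?B" using mult a addB by metis
    thus ?thesis using n by simp
  qed
  thus ?thesis using that by blast
qed

lemma index_pow_mat_Suc:
  fixes P :: "real mat"
  assumes "P \<in> carrier_mat M M" "i < M" "b < M"
  shows "(P ^\<^sub>m Suc n) $$ (i, b) = (\<Sum>c<M. (P ^\<^sub>m n) $$ (i, c) * P $$ (c, b))"
  using assms pow_carrier_mat[OF assms(1), of n]
  by (auto simp: scalar_prod_def lessThan_atLeast0 intro!: sum.cong)

lemma index_pow_mat_add:
  fixes P :: "real mat"
  assumes P: "P \<in> carrier_mat M M" and "i < M" "b < M"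
  shows "(P ^\<^sub>m (m + n)) $$ (i, b) = (\<Sum>c<M. (P ^\<^sub>m m) $$ (i, c) * (P ^\<^sub>m n) $$ (c, b))"
  using assms(3)
proof (induction n arbitrary: b)
  case 0
  have "(\<Sum>c<M. (P ^\<^sub>m m) $$ (i, c) * (1\<^sub>m M) $$ (c, b))
      = (\<Sum>c<M. if c = b then (P ^\<^sub>m m) $$ (i, c) else 0)"
    using 0 by (intro sum.cong) auto
  then show ?case using 0 P by simp
next
  case (Suc n)
  have "(P ^\<^sub>m (m + Suc n)) $$ (i, b)
      = (\<Sum>c<M. (\<Sum>a<M. (P ^\<^sub>m m) $$ (i, a) * (P ^\<^sub>m n) $$ (a, c)) * P $$ (c, b))"
    using index_pow_mat_Suc[OF P assms(2) Suc.prems, of "m + n"] Suc.IH by simp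
  also have "\<dots> = (\<Sum>a<M. (P ^\<^sub>m m) $$ (i, a) * (\<Sum>c<M. (P ^\<^sub>m n) $$ (a, c) * P $$ (c, b)))"
    unfolding sum_distrib_left sum_distrib_right mult.assoc by (rule sum.swap)
  also have "\<dots> = (\<Sum>a<M. (P ^\<^sub>m m) $$ (i, a) * (P ^\<^sub>m Suc n) $$ (a, b))"
    using index_pow_mat_Suc[OF P _ Suc.prems, of _ n] by (intro sum.cong) auto
  finally show ?case .
qed

lemma stochastic_matrix_pow:
  assumes P: "P \<in> carrier_mat M M" and st: "stochastic_matrix P" and i: "i < M"
  shows "b < M \<Longrightarrow> 0 \<le> (P ^\<^sub>m n) $$ (i, b)" "(\<Sum>b<M. (P ^\<^sub>m n) $$ (i, b)) = 1"
proof -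
  have st': "\<And>i b. i < M \<Longrightarrow> b < M \<Longrightarrow> 0 \<le> P $$ (i, b)" "\<And>i. i < M \<Longrightarrow> (\<Sum>b<M. P $$ (i, b)) = 1"
    using P st unfolding stochastic_matrix_def by auto
  show nn: "b < M \<Longrightarrow> 0 \<le> (P ^\<^sub>m n) $$ (i, b)" for b
  proof (induction n arbitrary: b)
    case 0
    then show ?case using P i by auto
  next
    case (Suc n)
    then show ?case using st' by (simp only: index_pow_mat_Suc[OF P i], auto intro!: sum_nonneg)
  qed
  show "(\<Sum>b<M. (P ^\<^sub>m n) $$ (i, b)) = 1"
  proof (induction n)
    case 0
    then show ?case using P i by simp
  next
    case (Suc n)
    have "(\<Sum>b<M. (P ^\<^sub>m Suc n) $$ (i, b)) = (\<Sum>b<M. \<Sum>c<M. (P ^\<^sub>m n) $$ (i, c) * P $$ (c, b))"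
      using index_pow_mat_Suc[OF P i] by (intro sum.cong) auto
    also have "\<dots> = (\<Sum>c<M. \<Sum>b<M. (P ^\<^sub>m n) $$ (i, c) * P $$ (c, b))" by (rule sum.swap)
    also have "\<dots> = (\<Sum>c<M. (P ^\<^sub>m n) $$ (i, c))"
      using st' by (simp flip: sum_distrib_left)
    finally show ?case using Suc by simp
  qed
qed

text \<open>A uniform stationary law makes \<open>P\<close> doubly stochastic, and this passes to
  powers. It is what makes the centred columns in \<open>geometric_mixing\<close> sum to
  zero.\<close>

lemma uniform_column_sum_pow:
  assumes P: "P \<in> carrier_mat M M" and M: "M \<ge> 1"
    and stat: "stationary_distribution P (\<lambda>i. 1 / real M)" and b: "b < M"
  shows "(\<Sum>i<M. (P ^\<^sub>m n) $$ (i, b)) = 1"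
  using b
proof (induction n arbitrary: b)
  case 0
  then show ?case using P by simp
next
  case (Suc n)
  have col: "(\<Sum>c<M. P $$ (c, b)) = 1"
  proof -
    have "(\<Sum>c<M. 1 / real M * P $$ (c, b)) = 1 / real M"
      using P stat Suc.prems unfolding stationary_distribution_def by auto
    thus ?thesis using M by (simp flip: sum_divide_distrib)
  qed
  have "(\<Sum>i<M. (P ^\<^sub>m Suc n) $$ (i, b)) = (\<Sum>i<M. \<Sum>c<M. (P ^\<^sub>m n) $$ (i, c) * P $$ (c, b))"
    using index_pow_mat_Suc[OF P _ Suc.prems] by (intro sum.cong) auto
  also have "\<dots> = (\<Sum>c<M. \<Sum>i<M. (P ^\<^sub>m n) $$ (i, c) * P $$ (c, b))" by (rule sum.swap)
  also have "\<dots> = (\<Sum>c<M. P $$ (c, b))" using Suc.IH by (simp flip: sum_distrib_right)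
  finally show ?case using col by simp
qed

text \<open>By aperiodicity each state has loops of every large length, and by irreducibility some
  path leads from i to b. A loop at i followed by that path can be given any large length, so one
  length serves all pairs of states.\<close>

lemma primitive_matrix:
  assumes P: "P \<in> carrier_mat M M" and st: "stochastic_matrix P"
    and irr: "irreducible_matrix P" and aper: "aperiodic_matrix P"
  obtains m where "m > 0" "\<And>i b. i < M \<Longrightarrow> b < M \<Longrightarrow> (P ^\<^sub>m m) $$ (i, b) > 0"
proof -
  note nn = stochastic_matrix_pow(1)[OF P st]
  have step: "(P ^\<^sub>m (m + n)) $$ (i, b) > 0"
    if "i < M" "c < M" "b < M" "(P ^\<^sub>m m) $$ (i, c) > 0" "(P ^\<^sub>m n) $$ (c, b) > 0" for i b c m n
    unfolding index_pow_mat_add[OF P that(1,3)]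
    by (rule sum_pos2[of _ c]) (use that nn in auto)
  have "\<exists>N. \<forall>n\<ge>N. n > 0 \<longrightarrow> (P ^\<^sub>m n) $$ (i, i) > 0" if i: "i < M" for i
  proof -
    let ?A = "{n. 0 < n \<and> (P ^\<^sub>m n) $$ (i, i) > 0}"
    have "Gcd ?A = 1" using aper i P unfolding aperiodic_matrix_def period_def by auto
    moreover have "a + b \<in> ?A" if "a \<in> ?A" "b \<in> ?A" for a b using step[OF i i i] that by auto
    ultimately obtain N where "\<And>n. n \<ge> N \<Longrightarrow> n > 0 \<Longrightarrow> n \<in> ?A"
      using additive_set_eventually_everything[of ?A] by blast
    thus ?thesis by blast
  qed
  then obtain N where N: "\<And>i n. i < M \<Longrightarrow> n \<ge> N i \<Longrightarrow> n > 0 \<Longrightarrow> (P ^\<^sub>m n) $$ (i, i) > 0" by metis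
  have "\<forall>i b. \<exists>n. i < M \<longrightarrow> b < M \<longrightarrow> (P ^\<^sub>m n) $$ (i, b) > 0"
    using irr P unfolding irreducible_matrix_def by auto
  then obtain h where h: "\<And>i b. i < M \<Longrightarrow> b < M \<Longrightarrow> (P ^\<^sub>m h i b) $$ (i, b) > 0" by metis
  \<comment> \<open>The sums dominate every single \<open>N i + h i b\<close>; the successor keeps
    the remaining loop length positive, as the loops come from a set without 0.\<close>
  define m where "m = Suc (\<Sum>i<M. N i + (\<Sum>b<M. h i b))"
  have "(P ^\<^sub>m m) $$ (i, b) > 0" if "i < M" "b < M" for i b
  proof -
    have "h i b \<le> (\<Sum>b<M. h i b)" by (rule member_le_sum) (use that in auto)
    moreover have "N i + (\<Sum>b<M. h i b) \<le> (\<Sum>i<M. N i + (\<Sum>b<M. h i b))"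
      by (rule member_le_sum[of i "{..<M}" "\<lambda>i. N i + (\<Sum>b<M. h i b)"]) (use that in auto)
    ultimately have "m > N i + h i b" by (simp add: m_def)
    hence "(P ^\<^sub>m ((m - h i b) + h i b)) $$ (i, b) > 0"
      by (intro step[OF that(1,1,2)] N h that) auto
    thus ?thesis using \<open>m > N i + h i b\<close> by simp
  qed
  thus ?thesis using that[of m] by (simp add: m_def)
qed

(* Columns of P^n - 1/M sum to zero, so subtracting a constant from the rows of the positive
   power P^m does not change its action on them. *)
lemma geometric_mixing:
  assumes P: "P \<in> carrier_mat M M" and st: "stochastic_matrix P" and M: "M \<ge> 1"
    and irr: "irreducible_matrix P" and aper: "aperiodic_matrix P"
    and stat: "stationary_distribution P (\<lambda>i. 1 / real M)"
  obtains C \<rho> where "C \<ge> 0" "0 < \<rho>" "\<rho> < 1"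
    "\<And>n i b. i < M \<Longrightarrow> b < M \<Longrightarrow> \<bar>(P ^\<^sub>m n) $$ (i, b) - 1 / real M\<bar> \<le> C * \<rho> ^ n"
proof -
  obtain m where m: "m > 0" "\<And>i b. i < M \<Longrightarrow> b < M \<Longrightarrow> (P ^\<^sub>m m) $$ (i, b) > 0"
    using primitive_matrix[OF P st irr aper] by metis
  define E where "E = Min ((\<lambda>(i, b). (P ^\<^sub>m m) $$ (i, b)) ` ({..<M} \<times> {..<M}))"
  have E0: "E > 0" unfolding E_def
    using M m by (subst Min_gr_iff) (auto simp: lessThan_empty_iff)
  have E: "E \<le> (P ^\<^sub>m m) $$ (i, b)" if "i < M" "b < M" for i b
    unfolding E_def using that by (intro Min_le) auto
  \<comment> \<open>Each row of \<open>P ^\<^sub>m m\<close> minus the constant \<open>E\<close> is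
    nonnegative with sum \<theta>, so it contracts the maximum norm by \<theta>.\<close>
  define \<theta> where "\<theta> = 1 - real M * E"
  have "(\<Sum>b<M. E) \<le> (\<Sum>b<M. (P ^\<^sub>m m) $$ (0, b))" using E M by (intro sum_mono) auto
  hence \<theta>: "0 \<le> \<theta>" "\<theta> < 1"
    using stochastic_matrix_pow(2)[OF P st, of 0 m] M E0 by (auto simp: \<theta>_def)
  define u where "u n i b = (P ^\<^sub>m n) $$ (i, b) - 1 / real M" for n i b
  have u1: "\<bar>u n i b\<bar> \<le> 1" if ib: "i < M" "b < M" for n i b
  proof -
    have "(P ^\<^sub>m n) $$ (i, b) \<le> (\<Sum>b<M. (P ^\<^sub>m n) $$ (i, b))"
      using stochastic_matrix_pow(1)[OF P st] ib by (intro member_le_sum) auto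
    hence "(P ^\<^sub>m n) $$ (i, b) \<le> 1" using stochastic_matrix_pow(2)[OF P st ib(1)] by simp
    moreover have "0 \<le> 1 / real M" "1 / real M \<le> 1" using M by auto
    ultimately show ?thesis using stochastic_matrix_pow(1)[OF P st ib, of n]
      unfolding u_def abs_le_iff by linarith
  qed
  have usum: "(\<Sum>i<M. u n i b) = 0" if "b < M" for n b
    using uniform_column_sum_pow[OF P M stat that] M by (simp add: u_def sum_subtractf)
  have contr: "\<bar>u (m + n) i b\<bar> \<le> \<theta> * B"
    if ib: "i < M" "b < M" and B: "\<And>i. i < M \<Longrightarrow> \<bar>u n i b\<bar> \<le> B" for n i b B
  proof -
    have "u (m + n) i b = (\<Sum>c<M. (P ^\<^sub>m m) $$ (i, c) * u n c b)"
      unfolding u_def index_pow_mat_add[OF P ib]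
      using stochastic_matrix_pow(2)[OF P st ib(1), of m]
      by (simp add: right_diff_distrib sum_subtractf flip: sum_divide_distrib)
    also have "\<dots> = (\<Sum>c<M. ((P ^\<^sub>m m) $$ (i, c) - E) * u n c b)"
      using usum[OF ib(2)] by (simp add: left_diff_distrib sum_subtractf flip: sum_distrib_left)
    also have "\<bar>\<dots>\<bar> \<le> (\<Sum>c<M. ((P ^\<^sub>m m) $$ (i, c) - E) * B)"
      using E ib B by (intro order_trans[OF sum_abs] sum_mono) (auto simp: abs_mult intro!: mult_mono)
    also have "\<dots> = \<theta> * B"
      using stochastic_matrix_pow(2)[OF P st ib(1), of m]
      by (simp add: \<theta>_def sum_subtractf flip: sum_distrib_right)
    finally show ?thesis .
  qed
  have pw: "\<bar>u (q * m + r) i b\<bar> \<le> \<theta> ^ q" if ib: "i < M" "b < M" for q r i b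
    using ib(1)
  proof (induction q arbitrary: i)
    case 0
    then show ?case using u1 ib by simp
  next
    case (Suc q)
    then show ?case using contr[OF Suc.prems ib(2), of "q * m + r" "\<theta> ^ q"] by (simp add: add.assoc)
  qed
  \<comment> \<open>\<theta> vanishes when the power is exactly uniform; the maximum keeps the rate
    positive, so that one may divide by it.\<close>
  define \<theta>' where "\<theta>' = max \<theta> (1/2)"
  have \<theta>': "0 < \<theta>'" "\<theta>' < 1" "\<theta> \<le> \<theta>'" using \<theta> by (auto simp: \<theta>'_def)
  define \<rho> where "\<rho> = root m \<theta>'"
  have \<rho>: "0 < \<rho>" "\<rho> < 1" "\<rho> ^ m = \<theta>'" using m(1) \<theta>' by (auto simp: \<rho>_def)
  have "\<bar>u n i b\<bar> \<le> (1 / \<theta>') * \<rho> ^ n" if ib: "i < M" "b < M" for n i b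
  proof -
    have "\<bar>u n i b\<bar> \<le> \<theta> ^ (n div m)" using pw[OF ib, of "n div m" "n mod m"] by simp
    also have "\<dots> \<le> \<theta>' ^ (n div m)" using \<theta> \<theta>' by (intro power_mono)
    \<comment> \<open>The exponent n is rounded up to a multiple of m, and the factor 1 / \<theta>'
      pays for the additional block.\<close>
    also have "\<dots> = (1 / \<theta>') * \<rho> ^ (m * Suc (n div m))"
      using \<theta>' by (simp add: power_mult \<rho>(3) del: mult_Suc_right)
    also have "\<dots> \<le> (1 / \<theta>') * \<rho> ^ n"
      using \<theta>' \<rho> m(1) dividend_less_times_div[of m n]
      by (intro mult_left_mono power_decreasing) (auto simp: less_imp_le)
    finally show ?thesis .
  qed
  thus ?thesis using that[of "1 / \<theta>'" \<rho>] \<theta>' \<rho> by (auto simp: u_def)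
qed

subsection \<open>Expectations along a Markov chain\<close>

text \<open>The states strictly before time k: exactly those that determine the iterate at time k.
  The current state is the last entry of \<open>history X (Suc k)\<close>.\<close>

definition history :: "(nat \<Rightarrow> 'w \<Rightarrow> nat) \<Rightarrow> nat \<Rightarrow> 'w \<Rightarrow> nat list" where
  "history X k \<omega> = map (\<lambda>i. X i \<omega>) [0..<k]"

lemma length_history [simp]: "length (history X k \<omega>) = k"
  by (simp add: history_def)

lemma take_history: "m \<le> k \<Longrightarrow> take m (history X k \<omega>) = history X m \<omega>"
  by (simp add: history_def take_map)

lemma history_Suc: "history X (Suc k) \<omega> = history X k \<omega> @ [X k \<omega>]"
  by (simp add: history_def)

lemma history_Suc_eq_iff:
  assumes "length s = Suc k"
  shows "history X (Suc k) \<omega> = s \<longleftrightarrow> (\<forall>i\<le>k. X i \<omega> = s ! i)"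
  using assms by (auto simp: list_eq_iff_nth_eq history_def less_Suc_eq_le simp del: upt_Suc)

locale markov_chain = prob_space S for S :: "'w measure" +
  fixes P :: "real mat" and M :: nat and X :: "nat \<Rightarrow> 'w \<Rightarrow> nat"
  assumes carrier_P: "P \<in> carrier_mat M M"
    and chain: "homogeneous_markov_chain S P X"
begin

definition histories :: "nat \<Rightarrow> nat list set" where
  "histories k = {s. set s \<subseteq> {..<M} \<and> length s = k}"

lemma dim_P: "dim_row P = M" using carrier_P by auto

lemma stochastic: "stochastic_matrix P"
  using chain by (simp add: homogeneous_markov_chain_def)

lemma finite_histories [simp]: "finite (histories k)"
  unfolding histories_def by (rule finite_lists_length_eq) simp

lemma measurable_state [measurable]: "X k \<in> measurable S (count_space UNIV)"
proof -
  have "X k \<in> measurable S (count_space {..<M})"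
    using chain by (simp add: homogeneous_markov_chain_def dim_P)
  thus ?thesis by (rule measurable_compose) simp
qed

lemma state_less: "\<omega> \<in> space S \<Longrightarrow> X k \<omega> < M"
  using chain measurable_space[of "X k" S "count_space {..<M}" \<omega>]
  by (simp add: homogeneous_markov_chain_def dim_P)

lemma history_in: "\<omega> \<in> space S \<Longrightarrow> history X k \<omega> \<in> histories k"
  using state_less by (auto simp: histories_def history_def)

lemma sets_history_eq [measurable]: "{\<omega> \<in> space S. history X k \<omega> = s} \<in> sets S"
proof -
  have "{\<omega> \<in> space S. history X k \<omega> = s} =
      {\<omega> \<in> space S. length s = k \<and> (\<forall>i\<in>{..<k}. X i \<omega> = s ! i)}"
    by (auto simp: list_eq_iff_nth_eq history_def)
  also have "\<dots> \<in> sets S" by measurable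
  finally show ?thesis .
qed

lemma measurable_history [measurable]: "history X k \<in> measurable S (count_space UNIV)"
proof (subst measurable_count_space_eq_countable)
  have "history X k -` {s} \<inter> space S = {\<omega> \<in> space S. history X k \<omega> = s}" for s by auto
  thus "history X k \<in> space S \<rightarrow> UNIV \<and> (\<forall>s\<in>UNIV. history X k -` {s} \<inter> space S \<in> sets S)"
    by (auto intro: sets_history_eq)
qed simp

text \<open>A function of the history takes finitely many values and is measurable for the discrete
  sigma-algebra, whatever \<phi> is. All integrability in the proof reduces to this.\<close>

lemma integrable_history:
  fixes \<phi> :: "nat list \<Rightarrow> real"
  assumes "\<And>\<omega>. \<omega> \<in> space S \<Longrightarrow> Y \<omega> = \<phi> (history X k \<omega>)"
  shows "integrable S Y"
proof -
  have "integrable S (\<lambda>\<omega>. \<phi> (history X k \<omega>))"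
  proof (rule integrable_const_bound)
    show "AE \<omega> in S. norm (\<phi> (history X k \<omega>)) \<le> Max ((\<lambda>s. norm (\<phi> s)) ` histories k)"
      using history_in by (intro AE_I2 Max_ge) auto
  qed (rule measurable_compose[OF measurable_history], simp)
  thus ?thesis using assms Bochner_Integration.integrable_cong[OF refl, of S Y] by simp
qed

lemma expectation_history:
  fixes \<phi> :: "nat list \<Rightarrow> real"
  shows "expectation (\<lambda>\<omega>. \<phi> (history X k \<omega>))
    = (\<Sum>s\<in>histories k. \<phi> s * \<P>(\<omega> in S. history X k \<omega> = s))"
proof -
  have "expectation (\<lambda>\<omega>. \<phi> (history X k \<omega>))
      = expectation (\<lambda>\<omega>. \<Sum>s\<in>histories k. \<phi> s * indicator {\<omega> \<in> space S. history X k \<omega> = s} \<omega>)"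
  proof (rule Bochner_Integration.integral_cong)
    fix \<omega> assume \<omega>: "\<omega> \<in> space S"
    have "(\<Sum>s\<in>histories k. \<phi> s * indicator {\<omega> \<in> space S. history X k \<omega> = s} \<omega>)
        = (\<Sum>s\<in>histories k. if s = history X k \<omega> then \<phi> s else 0)"
      using \<omega> by (intro sum.cong) (auto simp: indicator_def)
    thus "\<phi> (history X k \<omega>)
        = (\<Sum>s\<in>histories k. \<phi> s * indicator {\<omega> \<in> space S. history X k \<omega> = s} \<omega>)"
      using history_in[OF \<omega>] by simp
  qed simp
  also have "\<dots> = (\<Sum>s\<in>histories k. \<phi> s * \<P>(\<omega> in S. history X k \<omega> = s))"
    by (subst Bochner_Integration.integral_sum) (auto simp: integrable_real_indicator emeasure_eq_measure)
  finally show ?thesis .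
qed

lemma prob_history_Suc:
  assumes s: "s \<in> histories (Suc k)" and b: "b < M"
  shows "\<P>(\<omega> in S. history X (Suc (Suc k)) \<omega> = s @ [b])
    = P $$ (last s, b) * \<P>(\<omega> in S. history X (Suc k) \<omega> = s)"
proof -
  have len: "length s = Suc k" and lt: "\<forall>i\<le>k. s ! i < M"
    using s by (auto simp: histories_def subset_iff)
  have last: "last s = s ! k" using len by (cases s rule: rev_cases) (auto simp: nth_append)
  have ev: "{\<omega> \<in> space S. history X (Suc (Suc k)) \<omega> = s @ [b]}
      = {\<omega> \<in> space S. X (Suc k) \<omega> = b \<and> (\<forall>i\<le>k. X i \<omega> = s ! i)}"
    unfolding history_Suc[of X "Suc k"] by (auto simp: history_Suc_eq_iff[OF len])
  have ev': "{\<omega> \<in> space S. history X (Suc k) \<omega> = s} = {\<omega> \<in> space S. \<forall>i\<le>k. X i \<omega> = s ! i}"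
    by (simp add: history_Suc_eq_iff[OF len])
  show ?thesis
  proof (cases "\<P>(\<omega> in S. \<forall>i\<le>k. X i \<omega> = s ! i) > 0")
    case True
    hence "\<P>(\<omega> in S. X (Suc k) \<omega> = b \<bar> \<forall>i\<le>k. X i \<omega> = s ! i) = P $$ (s ! k, b)"
      using chain lt b unfolding homogeneous_markov_chain_def dim_P by blast
    thus ?thesis using True unfolding ev ev' last cond_prob_def by (simp add: field_simps)
  next
    \<comment> \<open>The Markov property is silent about a past of probability zero, but then both
      sides vanish.\<close>
    case False
    hence 0: "\<P>(\<omega> in S. \<forall>i\<le>k. X i \<omega> = s ! i) = 0" by (simp add: measure_le_0_iff not_less)
    have "\<P>(\<omega> in S. X (Suc k) \<omega> = b \<and> (\<forall>i\<le>k. X i \<omega> = s ! i)) \<le> \<P>(\<omega> in S. \<forall>i\<le>k. X i \<omega> = s ! i)"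
      by (rule finite_measure_mono) (use sets_history_eq[of "Suc k" s] in \<open>auto simp: ev'\<close>)
    with 0 show ?thesis unfolding ev ev' by (simp add: measure_le_0_iff)
  qed
qed

text \<open>The Markov property for functions of the whole past: a history of length k + 2 is a
  history of length k + 1 with one more state, whose conditional weight is an entry of
  \<open>P\<close>.\<close>

lemma expectation_one_step:
  fixes G :: "nat list \<Rightarrow> nat \<Rightarrow> real"
  shows "expectation (\<lambda>\<omega>. G (history X (Suc k) \<omega>) (X (Suc k) \<omega>))
    = expectation (\<lambda>\<omega>. \<Sum>b<M. P $$ (X k \<omega>, b) * G (history X (Suc k) \<omega>) b)"
proof -
  have split: "histories (Suc (Suc k)) = (\<lambda>(s, b). s @ [b]) ` (histories (Suc k) \<times> {..<M})"
  proof (intro equalityI subsetI)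
    fix t assume t: "t \<in> histories (Suc (Suc k))"
    then obtain s b where "t = s @ [b]" by (cases t rule: rev_cases) (auto simp: histories_def)
    thus "t \<in> (\<lambda>(s, b). s @ [b]) ` (histories (Suc k) \<times> {..<M})"
      using t by (auto simp: histories_def)
  qed (auto simp: histories_def)
  have "expectation (\<lambda>\<omega>. G (history X (Suc k) \<omega>) (X (Suc k) \<omega>))
      = expectation (\<lambda>\<omega>. (\<lambda>t. G (butlast t) (last t)) (history X (Suc (Suc k)) \<omega>))"
    by (simp add: history_Suc[of X "Suc k"])
  also have "\<dots> = (\<Sum>(s, b)\<in>histories (Suc k) \<times> {..<M}.
      G s b * \<P>(\<omega> in S. history X (Suc (Suc k)) \<omega> = s @ [b]))"
    unfolding expectation_history[of "\<lambda>t. G (butlast t) (last t)"] split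
    by (subst sum.reindex) (auto simp: inj_on_def case_prod_unfold)
  also have "\<dots> = (\<Sum>s\<in>histories (Suc k). \<Sum>b<M.
      G s b * \<P>(\<omega> in S. history X (Suc (Suc k)) \<omega> = s @ [b]))"
    by (rule sum.cartesian_product[symmetric])
  also have "\<dots> = (\<Sum>s\<in>histories (Suc k). (\<Sum>b<M. P $$ (last s, b) * G s b)
      * \<P>(\<omega> in S. history X (Suc k) \<omega> = s))"
    by (simp add: prob_history_Suc sum_distrib_right mult_ac)
  also have "\<dots> = expectation (\<lambda>\<omega>. \<Sum>b<M. P $$ (X k \<omega>, b) * G (history X (Suc k) \<omega>) b)"
    unfolding expectation_history[symmetric] by (simp add: history_Suc[of X k])
  finally show ?thesis .
qed

text \<open>The last transition is integrated out first, which replaces \<open>G\<close> by its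
  average over one row of \<open>P\<close>; the induction hypothesis is then applied to this
  averaged function, so \<open>G\<close> has to vary in the induction.\<close>

lemma expectation_n_steps:
  fixes G :: "nat list \<Rightarrow> nat \<Rightarrow> real"
  shows "expectation (\<lambda>\<omega>. G (history X (Suc k) \<omega>) (X (k + n) \<omega>))
    = expectation (\<lambda>\<omega>. \<Sum>b<M. (P ^\<^sub>m n) $$ (X k \<omega>, b) * G (history X (Suc k) \<omega>) b)"
proof (induction n arbitrary: G)
  case 0
  show ?case
  proof (rule Bochner_Integration.integral_cong)
    fix \<omega> assume \<omega>: "\<omega> \<in> space S"
    have "(\<Sum>b<M. (P ^\<^sub>m 0) $$ (X k \<omega>, b) * G (history X (Suc k) \<omega>) b)
        = (\<Sum>b<M. if b = X k \<omega> then G (history X (Suc k) \<omega>) b else 0)"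
      using state_less[OF \<omega>, of k] carrier_P by (intro sum.cong) auto
    thus "G (history X (Suc k) \<omega>) (X (k + 0) \<omega>)
        = (\<Sum>b<M. (P ^\<^sub>m 0) $$ (X k \<omega>, b) * G (history X (Suc k) \<omega>) b)"
      using state_less[OF \<omega>, of k] by simp
  qed simp
next
  case (Suc n)
  have "expectation (\<lambda>\<omega>. G (history X (Suc k) \<omega>) (X (k + Suc n) \<omega>))
      = expectation (\<lambda>\<omega>. \<Sum>b<M. P $$ (X (k + n) \<omega>, b) * G (history X (Suc k) \<omega>) b)"
    \<comment> \<open>The one-step rule conditions on the past up to k + n; \<open>take\<close> lets
      \<open>G\<close> see only its part up to k.\<close>
    using expectation_one_step[of "\<lambda>s. G (take (Suc k) s)" "k + n"]
    by (simp add: take_history)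
  also have "\<dots> = expectation (\<lambda>\<omega>. \<Sum>c<M. (P ^\<^sub>m n) $$ (X k \<omega>, c)
      * (\<Sum>b<M. P $$ (c, b) * G (history X (Suc k) \<omega>) b))"
    using Suc[of "\<lambda>s c. \<Sum>b<M. P $$ (c, b) * G s b"] .
  also have "\<dots> = expectation (\<lambda>\<omega>. \<Sum>b<M. (P ^\<^sub>m Suc n) $$ (X k \<omega>, b) * G (history X (Suc k) \<omega>) b)"
  proof (rule Bochner_Integration.integral_cong)
    fix \<omega> assume \<omega>: "\<omega> \<in> space S"
    let ?G = "G (history X (Suc k) \<omega>)"
    have "(\<Sum>b<M. (P ^\<^sub>m Suc n) $$ (X k \<omega>, b) * ?G b)
        = (\<Sum>b<M. \<Sum>c<M. (P ^\<^sub>m n) $$ (X k \<omega>, c) * (P $$ (c, b) * ?G b))"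
      using index_pow_mat_Suc[OF carrier_P state_less[OF \<omega>]]
      by (intro sum.cong) (auto simp: sum_distrib_right mult.assoc)
    also have "\<dots> = (\<Sum>c<M. (P ^\<^sub>m n) $$ (X k \<omega>, c) * (\<Sum>b<M. P $$ (c, b) * ?G b))"
      unfolding sum_distrib_left by (rule sum.swap)
    finally show "(\<Sum>c<M. (P ^\<^sub>m n) $$ (X k \<omega>, c) * (\<Sum>b<M. P $$ (c, b) * ?G b))
        = (\<Sum>b<M. (P ^\<^sub>m Suc n) $$ (X k \<omega>, b) * ?G b)" by simp
  qed simp
  finally show ?case .
qed

end

subsection \<open>Sums over logarithmic windows\<close>

lemma half_le_ln_plus2: "1 / 2 \<le> ln (real k + 2)"
proof -
  have "1 / 2 \<le> ln (2::real)" using ln2_ge_two_thirds by simp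
  also have "\<dots> \<le> ln (real k + 2)" by simp
  finally show ?thesis .
qed

text \<open>The weight in the stepsize condition vanishes at k = 1 and omits k = 0. The shifted
  logarithm is at least 1/2 everywhere, so later estimates hold at every index. The factor 4 comes
  from k + 2 \<le> k * k for k \<ge> 2, which at most doubles the logarithm.\<close>

lemma summable_ln_plus2_square:
  fixes \<gamma> :: "nat \<Rightarrow> real"
  assumes "summable (\<lambda>k. (ln (real (Suc k)))\<^sup>2 * (\<gamma> (Suc k))\<^sup>2)"
  shows "summable (\<lambda>k. (ln (real k + 2))\<^sup>2 * (\<gamma> k)\<^sup>2)"
proof (rule summable_comparison_test_ev)
  have "summable (\<lambda>k. (ln (real k))\<^sup>2 * (\<gamma> k)\<^sup>2)"
    using assms summable_Suc_iff[of "\<lambda>k. (ln (real k))\<^sup>2 * (\<gamma> k)\<^sup>2"] by simp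
  thus "summable (\<lambda>k. 4 * ((ln (real k))\<^sup>2 * (\<gamma> k)\<^sup>2))" by (rule summable_mult)
  show "\<forall>\<^sub>F k in sequentially. norm ((ln (real k + 2))\<^sup>2 * (\<gamma> k)\<^sup>2) \<le> 4 * ((ln (real k))\<^sup>2 * (\<gamma> k)\<^sup>2)"
    using eventually_ge_at_top[of "2::nat"]
  proof eventually_elim
    case (elim k)
    have "real k + 2 \<le> real k * 2" using elim by simp
    also have "\<dots> \<le> real k * real k" using elim by (intro mult_left_mono) auto
    finally have "ln (real k + 2) \<le> ln (real k * real k)" using elim by (subst ln_le_cancel_iff) auto
    also have "\<dots> = 2 * ln (real k)" using elim by (simp add: ln_mult)
    finally have "(ln (real k + 2))\<^sup>2 \<le> (2 * ln (real k))\<^sup>2"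
      using half_le_ln_plus2[of k] by (intro power_mono) auto
    hence "(ln (real k + 2))\<^sup>2 * (\<gamma> k)\<^sup>2 \<le> (2 * ln (real k))\<^sup>2 * (\<gamma> k)\<^sup>2"
      by (rule mult_right_mono) simp
    thus ?case by (simp add: power_mult_distrib)
  qed
qed

text \<open>The look-back distance at time k. With c = 1 / ln (1 / \<rho>) it is just long enough
  for \<rho> to this power to be at most 1 / (k + 2).\<close>

definition window :: "real \<Rightarrow> nat \<Rightarrow> nat" where
  "window c k = nat \<lceil>c * ln (real k + 2)\<rceil>"

lemma window_bounds:
  assumes "c \<ge> 0"
  shows "c * ln (real k + 2) \<le> real (window c k)" "real (window c k) \<le> c * ln (real k + 2) + 1"
proof -
  have "0 \<le> c * ln (real k + 2)" using assms half_le_ln_plus2[of k] by simp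
  thus "c * ln (real k + 2) \<le> real (window c k)" "real (window c k) \<le> c * ln (real k + 2) + 1"
    unfolding window_def by (auto simp: real_nat_ceiling_ge)
qed

text \<open>The window length is logarithmic in its right end k, but exchanging sums requires a
  bound in terms of the fixed index i. With t = k - i the condition reads t \<le> c ln (i + 2 + t) +
  1 at worst, and the contribution of t on the right can be absorbed into the left side.\<close>

lemma window_reach:
  assumes c: "c \<ge> 0"
  obtains A where "A \<ge> 0" "\<And>i k. i < k \<Longrightarrow> k - window c k \<le> i \<Longrightarrow> real (k - i) \<le> A * ln (real i + 2)"
proof -
  \<comment> \<open>The constant left after solving t \<le> c ln (i + 2) + (t + 1)/2 + c ln (2c + 1)
    + 1 for t.\<close>
  define K where "K = 2 * c * ln (2 * c + 1) + 3"
  have K: "K \<ge> 0" using c by (simp add: K_def)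
  have "real (k - i) \<le> (2 * c + 2 * K) * ln (real i + 2)" if ik: "i < k" "k - window c k \<le> i" for i k
  proof -
    define t where "t = real (k - i)"
    have t: "t > 0" "real k = real i + t" using ik by (auto simp: t_def)
    have "t \<le> real (window c k)" using ik unfolding t_def by linarith
    also have "\<dots> \<le> c * ln (real k + 2) + 1" using window_bounds[OF c] by blast
    finally have t_le: "t \<le> c * ln (real k + 2) + 1" .
    have "ln (real k + 2) \<le> ln ((real i + 2) * (t + 1))"
    proof (subst ln_le_cancel_iff)
      have "0 \<le> t * real i" using t by simp
      thus "real k + 2 \<le> (real i + 2) * (t + 1)" using t by (simp add: algebra_simps)
    qed (use t in auto)
    also have "\<dots> = ln (real i + 2) + ln (t + 1)" using t by (simp add: ln_mult)
    finally have "c * ln (real k + 2) \<le> c * (ln (real i + 2) + ln (t + 1))" using c by (rule mult_left_mono)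
    with t_le have *: "t \<le> c * ln (real i + 2) + c * ln (t + 1) + 1" by (simp add: algebra_simps)
    \<comment> \<open>The tangent of ln at 2c + 1 bounds the logarithm by a line of slope 1 / (2c +
      1). After multiplication by c the slope is at most 1/2, so half of t survives on the
      left.\<close>
    have "ln (t + 1) = ln ((t + 1) / (2 * c + 1)) + ln (2 * c + 1)"
      using t c by (simp add: ln_div)
    also have "\<dots> \<le> (t + 1) / (2 * c + 1) - 1 + ln (2 * c + 1)"
      using t c by (intro add_right_mono ln_le_minus_one) auto
    finally have "ln (t + 1) \<le> (t + 1) / (2 * c + 1) + ln (2 * c + 1)" by simp
    hence "c * ln (t + 1) \<le> c * ((t + 1) / (2 * c + 1) + ln (2 * c + 1))" using c by (rule mult_left_mono)
    also have "\<dots> = c / (2 * c + 1) * (t + 1) + c * ln (2 * c + 1)" by (simp add: distrib_left add_divide_distrib)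
    also have "c / (2 * c + 1) * (t + 1) \<le> 1 / 2 * (t + 1)"
      using t c by (intro mult_right_mono) (auto simp: divide_le_eq)
    finally have "c * ln (t + 1) \<le> 1 / 2 * (t + 1) + c * ln (2 * c + 1)" by simp
    moreover have "u \<le> 2 * a + (2 * b + 3)" if "u \<le> a + d + 1" "d \<le> 1 / 2 * (u + 1) + b" for a b d u :: real
      using that by (simp add: field_simps)
    ultimately have "t \<le> 2 * (c * ln (real i + 2)) + (2 * (c * ln (2 * c + 1)) + 3)"
      using * by blast
    hence "t \<le> 2 * c * ln (real i + 2) + K" by (simp add: K_def mult.assoc)
    \<comment> \<open>Since the logarithm is at least 1/2, the additive constant turns into a
      multiple of it.\<close>
    moreover have "K * 1 \<le> K * (2 * ln (real i + 2))"
      using half_le_ln_plus2[of i] K by (intro mult_left_mono) auto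
    ultimately show ?thesis by (simp add: t_def algebra_simps)
  qed
  thus ?thesis using that[of "2 * c + 2 * K"] c K by auto
qed

text \<open>Exchanging the order of summation counts \<open>u i\<close> once for each k whose window
  contains i, and by \<open>window_reach\<close> there are at most A ln (i + 2) of these. A window
  thus costs one logarithm.\<close>

lemma summable_window_sum:
  fixes a :: "nat \<Rightarrow> nat \<Rightarrow> real" and u :: "nat \<Rightarrow> real"
  assumes c: "c \<ge> 0" and a0: "\<And>k i. 0 \<le> a k i" and au: "\<And>k i. i < k \<Longrightarrow> a k i \<le> u i"
    and summable: "summable (\<lambda>i. u i * ln (real i + 2))"
  shows "summable (\<lambda>k. \<Sum>i\<in>{k - window c k..<k}. a k i)"
proof -
  have u0: "u i \<ge> 0" for i using a0[of "Suc i" i] au[of i "Suc i"] by simp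
  obtain A where A: "A \<ge> 0" "\<And>i k. i < k \<Longrightarrow> k - window c k \<le> i \<Longrightarrow> real (k - i) \<le> A * ln (real i + 2)"
    using window_reach[OF c] by blast
  have ln0: "0 \<le> ln (real i + 2)" for i using half_le_ln_plus2[of i] by simp
  show ?thesis
  proof (rule summableI_nonneg_bounded)
    fix N
    let ?W = "\<lambda>i. {k\<in>{..<N}. i < k \<and> k - window c k \<le> i}"
    have card_W: "real (card (?W i)) \<le> A * ln (real i + 2)" for i
    proof -
      have "?W i \<subseteq> {i<..i + nat \<lfloor>A * ln (real i + 2)\<rfloor>}"
      proof
        fix k assume k: "k \<in> ?W i"
        hence "real (k - i) \<le> A * ln (real i + 2)" by (intro A(2)) auto
        hence "k - i \<le> nat \<lfloor>A * ln (real i + 2)\<rfloor>" by (simp add: le_nat_floor)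
        thus "k \<in> {i<..i + nat \<lfloor>A * ln (real i + 2)\<rfloor>}" using k by auto
      qed
      hence "card (?W i) \<le> nat \<lfloor>A * ln (real i + 2)\<rfloor>"
        using card_mono[of "{i<..i + nat \<lfloor>A * ln (real i + 2)\<rfloor>}" "?W i"] by simp
      hence "real (card (?W i)) \<le> real (nat \<lfloor>A * ln (real i + 2)\<rfloor>)" by simp
      also have "\<dots> \<le> A * ln (real i + 2)" using A(1) ln0[of i] by (intro of_nat_floor) auto
      finally show ?thesis .
    qed
    have "(\<Sum>k<N. \<Sum>i\<in>{k - window c k..<k}. a k i)
        \<le> (\<Sum>k<N. \<Sum>i\<in>{k - window c k..<k}. u i)"
      using au by (intro sum_mono) auto
    also have "\<dots> = (\<Sum>k<N. \<Sum>i<N. if i < k \<and> k - window c k \<le> i then u i else 0)"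
    proof (rule sum.cong[OF refl])
      fix k assume "k \<in> {..<N}"
      hence "{i\<in>{..<N}. i < k \<and> k - window c k \<le> i} = {k - window c k..<k}" by auto
      thus "sum u {k - window c k..<k} = (\<Sum>i<N. if i < k \<and> k - window c k \<le> i then u i else 0)"
        using sum.inter_filter[of "{..<N}" u "\<lambda>i. i < k \<and> k - window c k \<le> i"] by simp
    qed
    also have "\<dots> = (\<Sum>i<N. \<Sum>k<N. if i < k \<and> k - window c k \<le> i then u i else 0)"
      by (rule sum.swap)
    also have "\<dots> = (\<Sum>i<N. u i * real (card (?W i)))"
      by (intro sum.cong refl, subst sum.inter_filter[symmetric]) (auto simp: mult.commute)
    also have "\<dots> \<le> (\<Sum>i<N. u i * (A * ln (real i + 2)))"
      using card_W u0 by (intro sum_mono mult_left_mono) auto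
    also have "\<dots> = A * (\<Sum>i<N. u i * ln (real i + 2))" by (simp add: sum_distrib_left mult_ac)
    also have "\<dots> \<le> A * (\<Sum>i. u i * ln (real i + 2))"
      using A(1) summable u0 ln0 by (intro mult_left_mono sum_le_suminf) auto
    finally show "(\<Sum>k<N. \<Sum>i\<in>{k - window c k..<k}. a k i) \<le> A * (\<Sum>i. u i * ln (real i + 2))" .
  qed (auto intro: sum_nonneg a0)
qed

lemma summable_bounded:
  fixes f :: "nat \<Rightarrow> real"
  assumes "summable f"
  obtains B where "B \<ge> 0" "\<And>k. \<bar>f k\<bar> \<le> B"
proof -
  have "Bseq f" using assms by (intro convergent_imp_Bseq) (auto simp: convergent_def dest: summable_LIMSEQ_zero)
  thus ?thesis using that by (elim BseqE) (metis less_imp_le real_norm_def)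
qed

text \<open>For the stepsizes, the product \<gamma> k * \<gamma> i is split into squares: one is
  summed over windows, the other is multiplied by the window length, and each costs one logarithm.
  For the noise, \<gamma> k * ln (k + 2) is bounded because its square is summable; as i < k, this
  gives \<gamma> k \<le> B / ln (i + 2), which cancels the logarithm that the window costs.\<close>

lemma summable_window_terms:
  fixes \<gamma> \<eta> :: "nat \<Rightarrow> real"
  assumes c: "c \<ge> 0" and \<gamma>: "\<And>k. 0 \<le> \<gamma> k" and \<eta>: "\<And>k. 0 \<le> \<eta> k"
    and sq: "summable (\<lambda>k. (ln (real k + 2))\<^sup>2 * (\<gamma> k)\<^sup>2)" and s\<eta>: "summable \<eta>"
  shows "summable (\<lambda>k. \<gamma> k * (\<Sum>i\<in>{k - window c k..<k}. \<gamma> i))"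
    and "summable (\<lambda>k. \<gamma> k * (\<Sum>i\<in>{k - window c k..<k}. \<eta> i))"
proof -
  let ?l = "\<lambda>k. ln (real k + 2)"
  have l: "1 / 2 \<le> ?l k" for k by (rule half_le_ln_plus2)
  have l2: "?l k \<le> 2 * (?l k)\<^sup>2" "1 \<le> 4 * (?l k)\<^sup>2" for k
  proof -
    have "1 * ?l k \<le> (2 * ?l k) * ?l k" using l[of k] by (intro mult_right_mono) auto
    thus A: "?l k \<le> 2 * (?l k)\<^sup>2" by (simp add: power2_eq_square)
    show "1 \<le> 4 * (?l k)\<^sup>2" using A l[of k] by simp
  qed
  obtain B where B: "B \<ge> 0" "\<And>k. \<bar>(?l k)\<^sup>2 * (\<gamma> k)\<^sup>2\<bar> \<le> B\<^sup>2"
  proof -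
    obtain B where "B \<ge> 0" "\<And>k. \<bar>(?l k)\<^sup>2 * (\<gamma> k)\<^sup>2\<bar> \<le> B" using summable_bounded[OF sq] by blast
    thus ?thesis using that[of "sqrt B"] by simp
  qed
  have B': "\<gamma> k * ?l k \<le> B" for k
  proof (rule power2_le_imp_le)
    show "(\<gamma> k * ?l k)\<^sup>2 \<le> B\<^sup>2" using B(2)[of k] by (simp add: power_mult_distrib mult.commute)
  qed (rule B(1))
  show "summable (\<lambda>k. \<gamma> k * (\<Sum>i\<in>{k - window c k..<k}. \<eta> i))"
    unfolding sum_distrib_left
  proof (rule summable_window_sum[OF c, where u = "\<lambda>i. B * \<eta> i / ?l i"])
    have "summable (\<lambda>i. B * \<eta> i)" using s\<eta> by (rule summable_mult)
    moreover have "B * \<eta> i = B * \<eta> i / ?l i * ?l i" for i using l[of i] by simp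
    ultimately show "summable (\<lambda>i. B * \<eta> i / ?l i * ?l i)" by simp
    fix k i :: nat assume "i < k"
    hence "\<gamma> k * ?l i \<le> \<gamma> k * ?l k" using \<gamma> by (intro mult_left_mono) auto
    also have "\<dots> \<le> B" by (rule B')
    finally have "\<gamma> k \<le> B / ?l i" using l[of i] by (simp add: field_simps)
    thus "\<gamma> k * \<eta> i \<le> B * \<eta> i / ?l i" using \<eta>[of i] mult_right_mono by fastforce
  qed (use \<gamma> \<eta> in auto)
  have 1: "summable (\<lambda>k. \<Sum>i\<in>{k - window c k..<k}. (\<gamma> i)\<^sup>2)"
  proof (rule summable_window_sum[OF c, where u = "\<lambda>i. (\<gamma> i)\<^sup>2"])
    show "summable (\<lambda>i. (\<gamma> i)\<^sup>2 * ?l i)"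
    proof (rule summable_comparison_test'[OF summable_mult[OF sq, of 2], of 0])
      fix i
      have "(\<gamma> i)\<^sup>2 * ?l i \<le> (\<gamma> i)\<^sup>2 * (2 * (?l i)\<^sup>2)" using l2 by (intro mult_left_mono) auto
      thus "norm ((\<gamma> i)\<^sup>2 * ?l i) \<le> 2 * ((?l i)\<^sup>2 * (\<gamma> i)\<^sup>2)" using l[of i] by (simp add: mult_ac)
    qed
  qed auto
  have 2: "summable (\<lambda>k. real (window c k) * (\<gamma> k)\<^sup>2)"
  proof (rule summable_comparison_test'[OF summable_mult[OF sq, of "2 * c + 4"], of 0])
    fix k
    have "real (window c k) \<le> c * ?l k + 1" by (rule window_bounds[OF c])
    also have "\<dots> \<le> c * (2 * (?l k)\<^sup>2) + 4 * (?l k)\<^sup>2" using l2 c by (intro add_mono mult_left_mono) auto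
    finally have "real (window c k) * (\<gamma> k)\<^sup>2 \<le> (c * (2 * (?l k)\<^sup>2) + 4 * (?l k)\<^sup>2) * (\<gamma> k)\<^sup>2"
      by (rule mult_right_mono) simp
    thus "norm (real (window c k) * (\<gamma> k)\<^sup>2) \<le> (2 * c + 4) * ((?l k)\<^sup>2 * (\<gamma> k)\<^sup>2)"
      by (simp add: algebra_simps)
  qed
  show "summable (\<lambda>k. \<gamma> k * (\<Sum>i\<in>{k - window c k..<k}. \<gamma> i))"
  proof (rule summable_comparison_test'[OF summable_add[OF 1 2], of 0])
    fix k
    have "\<gamma> k * (\<Sum>i\<in>{k - window c k..<k}. \<gamma> i) = (\<Sum>i\<in>{k - window c k..<k}. \<gamma> k * \<gamma> i)"
      by (rule sum_distrib_left)
    also have "\<dots> \<le> (\<Sum>i\<in>{k - window c k..<k}. (\<gamma> i)\<^sup>2 + (\<gamma> k)\<^sup>2)"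
    proof (rule sum_mono)
      fix i show "\<gamma> k * \<gamma> i \<le> (\<gamma> i)\<^sup>2 + (\<gamma> k)\<^sup>2"
        using sum_squares_bound[of "\<gamma> k" "\<gamma> i"] mult_nonneg_nonneg[OF \<gamma>[of k] \<gamma>[of i]] by linarith
    qed
    also have "\<dots> = (\<Sum>i\<in>{k - window c k..<k}. (\<gamma> i)\<^sup>2) + real (k - (k - window c k)) * (\<gamma> k)\<^sup>2"
      by (simp add: sum.distrib)
    also have "\<dots> \<le> (\<Sum>i\<in>{k - window c k..<k}. (\<gamma> i)\<^sup>2) + real (window c k) * (\<gamma> k)\<^sup>2"
      by (intro add_left_mono mult_right_mono) auto
    finally show "norm (\<gamma> k * (\<Sum>i\<in>{k - window c k..<k}. \<gamma> i))
        \<le> (\<Sum>i\<in>{k - window c k..<k}. (\<gamma> i)\<^sup>2) + real (window c k) * (\<gamma> k)\<^sup>2"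
      using \<gamma> by (simp add: sum_nonneg)
  qed
qed

(* The increments of the cubes are summable although those of the sequence itself need not be. *)
lemma slowly_varying_tendsto_zero:
  fixes a \<gamma> \<eta> :: "nat \<Rightarrow> real"
  assumes a: "\<And>k. 0 \<le> a k" "\<And>k. a k \<le> D" and \<gamma>: "\<And>k. 0 \<le> \<gamma> k" and \<eta>: "\<And>k. 0 \<le> \<eta> k" and C: "C \<ge> 0"
    and step: "\<And>k. \<bar>a (Suc k) - a k\<bar> \<le> C * \<gamma> k + \<eta> k"
    and s\<eta>: "summable \<eta>" and sq: "summable (\<lambda>k. (\<gamma> k)\<^sup>2)" and sa: "summable (\<lambda>k. \<gamma> k * (a k)\<^sup>2)"
    and div: "\<not> summable \<gamma>"
  shows "a \<longlonglongrightarrow> 0"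
proof -
  have D: "D \<ge> 0" using a[of 0] by linarith
  obtain G where G: "G \<ge> 0" "\<And>k. \<gamma> k \<le> G"
  proof -
    obtain B where "B \<ge> 0" "\<And>k. \<bar>(\<gamma> k)\<^sup>2\<bar> \<le> B" using summable_bounded[OF sq] by blast
    thus ?thesis using that[of "sqrt B"] by (simp add: real_le_rsqrt)
  qed
  \<comment> \<open>The increment of the cubes is that of the sequence times y^2 + xy + x^2. Its
    \<eta> part uses the crude bound 3 D^2 for the second factor; its \<gamma> part needs a bound by
    x^2, where \<gamma> x^2 is summable, and by the squared increment.\<close>
  define b where "b k = 3 * D\<^sup>2 * \<eta> k + C * (9/2 * (\<gamma> k * (a k)\<^sup>2) + 3 * D * (C * (\<gamma> k)\<^sup>2 + G * \<eta> k))" for k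
  have "summable b" unfolding b_def by (intro summable_add summable_mult s\<eta> sq sa)
  have le: "\<bar>a (Suc k) ^ 3 - a k ^ 3\<bar> \<le> b k" for k
  proof -
    define x y d where "x = a k" and "y = a (Suc k)" and "d = \<bar>y - x\<bar>"
    have xy: "0 \<le> x" "x \<le> D" "0 \<le> y" "y \<le> D" using a by (auto simp: x_def y_def)
    have d: "0 \<le> d" "d \<le> D" "d \<le> C * \<gamma> k + \<eta> k" using xy step by (auto simp: d_def x_def y_def)
    let ?s = "y\<^sup>2 + x * y + x\<^sup>2"
    have s0: "0 \<le> ?s" using xy by simp
    have sD: "?s \<le> 3 * D\<^sup>2"
    proof -
      have "y\<^sup>2 \<le> D\<^sup>2" "x\<^sup>2 \<le> D\<^sup>2" using xy by (auto intro: power_mono)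
      moreover have "x * y \<le> D * D" using xy D by (intro mult_mono) auto
      ultimately show ?thesis by (simp add: power2_eq_square)
    qed
    \<comment> \<open>With y = x + h the left side is 3x^2 + 3xh + h^2, and 3xh is at most 3/2 (x^2
      + h^2). This yields 9/2 x^2 + 5/2 h^2, rounded up in the second coefficient.\<close>
    have sx: "?s \<le> 9/2 * x\<^sup>2 + 3 * d\<^sup>2"
    proof -
      have "d\<^sup>2 = (y - x)\<^sup>2" by (simp add: d_def)
      moreover have "9/2 * x\<^sup>2 + 3 * (y - x)\<^sup>2 - ?s = (13/2) * x\<^sup>2 - 7 * (x * y) + 2 * y\<^sup>2"
        by (simp add: power2_eq_square algebra_simps)
      moreover have "(13/2) * x\<^sup>2 - 7 * (x * y) + 2 * y\<^sup>2 = 2 * (y - 7/4 * x)\<^sup>2 + 3/8 * x\<^sup>2"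
        by (simp add: power2_eq_square algebra_simps)
      moreover have "0 \<le> 2 * (y - 7/4 * x)\<^sup>2 + 3/8 * x\<^sup>2" by simp
      ultimately show ?thesis by linarith
    qed
    have gk: "\<gamma> k * (9/2 * x\<^sup>2 + 3 * d\<^sup>2) \<le> 9/2 * (\<gamma> k * x\<^sup>2) + 3 * D * (C * (\<gamma> k)\<^sup>2 + G * \<eta> k)"
    proof -
      have "\<gamma> k * d\<^sup>2 \<le> \<gamma> k * (D * (C * \<gamma> k + \<eta> k))"
        using d D \<gamma> by (intro mult_left_mono) (auto simp: power2_eq_square intro!: mult_mono)
      also have "\<dots> = D * (C * (\<gamma> k)\<^sup>2 + \<gamma> k * \<eta> k)" by (simp add: power2_eq_square algebra_simps)
      also have "\<dots> \<le> D * (C * (\<gamma> k)\<^sup>2 + G * \<eta> k)"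
        using D G \<eta> by (intro mult_left_mono add_left_mono mult_right_mono) auto
      finally show ?thesis by (simp add: algebra_simps)
    qed
    have "y ^ 3 - x ^ 3 = (y - x) * ?s" by (simp add: power3_eq_cube power2_eq_square algebra_simps)
    hence "\<bar>y ^ 3 - x ^ 3\<bar> = d * ?s" using s0 by (simp add: abs_mult d_def)
    also have "\<dots> \<le> (C * \<gamma> k + \<eta> k) * ?s" using d s0 by (intro mult_right_mono) auto
    also have "\<dots> = C * (\<gamma> k * ?s) + \<eta> k * ?s" by (simp add: algebra_simps)
    also have "\<dots> \<le> C * (\<gamma> k * (9/2 * x\<^sup>2 + 3 * d\<^sup>2)) + \<eta> k * (3 * D\<^sup>2)"
      by (intro add_mono mult_left_mono sx sD \<gamma> \<eta> C)
    also have "\<dots> \<le> C * (9/2 * (\<gamma> k * x\<^sup>2) + 3 * D * (C * (\<gamma> k)\<^sup>2 + G * \<eta> k)) + \<eta> k * (3 * D\<^sup>2)"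
      by (intro add_right_mono mult_left_mono gk C)
    finally show ?thesis by (simp add: b_def x_def y_def mult.commute add.commute)
  qed
  have "summable (\<lambda>k. a (Suc k) ^ 3 - a k ^ 3)"
    by (rule summable_comparison_test'[OF \<open>summable b\<close>, of 0]) (use le in auto)
  hence "(\<lambda>n. \<Sum>k<n. a (Suc k) ^ 3 - a k ^ 3) \<longlonglongrightarrow> (\<Sum>k. a (Suc k) ^ 3 - a k ^ 3)"
    by (rule summable_LIMSEQ)
  hence "(\<lambda>n. (a n ^ 3 - a 0 ^ 3) + a 0 ^ 3) \<longlonglongrightarrow> (\<Sum>k. a (Suc k) ^ 3 - a k ^ 3) + a 0 ^ 3"
    unfolding sum_lessThan_telescope[of "\<lambda>k. a k ^ 3"] by (intro tendsto_intros)
  then obtain l where l: "(\<lambda>n. a n ^ 3) \<longlonglongrightarrow> l" by auto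
  have "l \<ge> 0" using a by (intro LIMSEQ_le_const[OF l]) auto
  \<comment> \<open>A positive limit would keep a^2 above l / (2D) from some index on, since a^3
    \<le> D a^2. Then \<gamma> would be dominated by a multiple of the summable \<gamma>
    a^2.\<close>
  have "l = 0"
  proof (rule ccontr)
    assume "l \<noteq> 0"
    hence "l > 0" using \<open>l \<ge> 0\<close> by simp
    have "\<forall>\<^sub>F k in sequentially. a k ^ 3 > l / 2"
      using l \<open>l > 0\<close> by (intro order_tendstoD(1)[OF l]) auto
    hence "\<forall>\<^sub>F k in sequentially. norm (\<gamma> k) \<le> (2 * D / l) * (\<gamma> k * (a k)\<^sup>2)"
    proof eventually_elim
      case (elim k)
      have "a k ^ 3 = a k * (a k)\<^sup>2" by (simp add: power3_eq_cube power2_eq_square)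
      also have "\<dots> \<le> D * (a k)\<^sup>2" by (rule mult_right_mono[OF a(2)]) simp
      finally have "l \<le> 2 * D * (a k)\<^sup>2" using elim by linarith
      hence "1 \<le> 2 * D * (a k)\<^sup>2 / l" using \<open>l > 0\<close> by (simp add: le_divide_eq)
      hence "\<gamma> k * 1 \<le> \<gamma> k * (2 * D * (a k)\<^sup>2 / l)" by (rule mult_left_mono[OF _ \<gamma>])
      thus ?case using \<gamma>[of k] by (simp add: mult_ac)
    qed
    hence "summable \<gamma>" by (rule summable_comparison_test_ev) (rule summable_mult[OF sa])
    with div show False by simp
  qed
  hence "(\<lambda>n. root 3 (a n ^ 3)) \<longlonglongrightarrow> 0" using tendsto_real_root[OF l, of 3] by simp
  moreover have "root 3 (a n ^ 3) = a n" for n using a(1) by (intro real_root_power_cancel) auto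
  ultimately show ?thesis by simp
qed

text \<open>For k \<ge> 2N at least k/2 indices lie between N and k, and each of their terms is at
  least c k^(-q), because the power decreases. Taking N \<ge> 1 keeps these indices in the range of
  the sum and the bases positive.\<close>

lemma sum_powr_lower_bound:
  fixes \<gamma> :: "nat \<Rightarrow> real"
  assumes pos: "\<And>k. 0 < \<gamma> k" and q: "0 \<le> q" and \<gamma>: "\<gamma> \<in> \<Omega>(\<lambda>k. real k powr (- q))"
  shows "(\<lambda>k. \<Sum>i=1..k. \<gamma> i) \<in> \<Omega>(\<lambda>k. real k powr (1 - q))"
proof -
  obtain c where c: "c > 0" "\<forall>\<^sub>F k in sequentially. c * norm (real k powr (- q)) \<le> norm (\<gamma> k)"
    by (rule landau_omega.bigE[OF \<gamma>])
  then obtain N0 where "\<And>k. k \<ge> N0 \<Longrightarrow> c * real k powr (- q) \<le> \<gamma> k"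
    using pos unfolding eventually_sequentially by (auto simp: abs_of_pos)
  then obtain N where N: "N \<ge> 1" "\<And>k. k \<ge> N \<Longrightarrow> c * real k powr (- q) \<le> \<gamma> k"
    by (metis max.boundedE max.cobounded1)
  have "\<forall>\<^sub>F k in sequentially. norm (\<Sum>i=1..k. \<gamma> i) \<ge> (c / 2) * norm (real k powr (1 - q))"
    using eventually_ge_at_top[of "2 * N"]
  proof eventually_elim
    case (elim k)
    have k: "k \<ge> 1" "k \<ge> N" using elim N by auto
    have "(c / 2) * real k powr (1 - q) = (real k / 2) * (c * real k powr (- q))"
      using k by (simp add: powr_diff powr_minus field_simps)
    also have "\<dots> \<le> real (card {N..k}) * (c * real k powr (- q))"
      using elim c by (intro mult_right_mono) auto
    also have "\<dots> = (\<Sum>i\<in>{N..k}. c * real k powr (- q))" by simp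
    also have "\<dots> \<le> (\<Sum>i\<in>{N..k}. \<gamma> i)"
    proof (rule sum_mono)
      fix i assume i: "i \<in> {N..k}"
      have "c * real k powr (- q) \<le> c * real i powr (- q)"
        using i N c q by (intro mult_left_mono powr_mono2') auto
      also have "\<dots> \<le> \<gamma> i" using i N by auto
      finally show "c * real k powr (- q) \<le> \<gamma> i" .
    qed
    also have "\<dots> \<le> (\<Sum>i=1..k. \<gamma> i)" using N pos by (intro sum_mono2) (auto simp: less_imp_le)
    finally show ?case by simp
  qed
  thus ?thesis using c(1) by (intro landau_omega.bigI[of "c / 2"]) auto
qed

section \<open>Gradients and descent for functions with Lipschitz gradient\<close>

lemma grad_eq:
  fixes g :: "'a::euclidean_space \<Rightarrow> real"
  assumes "GDERIV g z :> v"
  shows "grad g z = v"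
proof -
  have "g differentiable (at z)" using assms by (auto simp: gderiv_def differentiable_def)
  hence "GDERIV g z :> grad g z" by (rule GDERIV_grad)
  hence "(\<lambda>h. inner h (grad g z)) = (\<lambda>h. inner h v)"
    using assms unfolding gderiv_def by (rule has_derivative_unique)
  thus ?thesis by (metis vector_eq_rdot inner_commute)
qed

text \<open>The mean value theorem on the segment from u to v gives the gradient at an intermediate
  point, and the Lipschitz bound moves it to u. Avoiding an integral costs a factor 2: the constant
  is L instead of L/2.\<close>

lemma descent_inequality:
  fixes F :: "'a::euclidean_space \<Rightarrow> real"
  assumes diff: "\<And>z. F differentiable (at z)"
    and lip: "\<And>u v. norm (grad F u - grad F v) \<le> L * norm (u - v)"
  shows "F v \<le> F u + inner (grad F u) (v - u) + L * (norm (v - u))\<^sup>2"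
proof -
  have L: "L * norm (v - u) \<ge> 0" using order_trans[OF norm_ge_zero lip[of v u]] .
  have deriv: "((\<lambda>t. F (u + t *\<^sub>R (v - u))) has_real_derivative
      inner (grad F (u + t *\<^sub>R (v - u))) (v - u)) (at t)" for t
  proof -
    have "(F has_derivative (\<lambda>h. inner h (grad F (u + t *\<^sub>R (v - u))))) (at (u + t *\<^sub>R (v - u)))"
      using GDERIV_grad[OF diff] by (simp add: gderiv_def)
    moreover have "((\<lambda>t. u + t *\<^sub>R (v - u)) has_derivative (\<lambda>h. h *\<^sub>R (v - u))) (at t)"
      by (auto intro!: derivative_eq_intros)
    ultimately have "((\<lambda>t. F (u + t *\<^sub>R (v - u))) has_derivative
        (\<lambda>h. inner (h *\<^sub>R (v - u)) (grad F (u + t *\<^sub>R (v - u))))) (at t)"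
      using has_derivative_compose by blast
    thus ?thesis
      by (rule has_derivative_imp_has_field_derivative) (simp add: inner_commute)
  qed
  have "\<exists>t>0. t < 1 \<and> F (u + 1 *\<^sub>R (v - u)) - F (u + 0 *\<^sub>R (v - u))
      = (1 - 0) * inner (grad F (u + t *\<^sub>R (v - u))) (v - u)"
    by (rule MVT2) (simp_all only: deriv zero_less_one)
  then obtain t where t: "0 < t" "t < 1" "F v - F u = inner (grad F (u + t *\<^sub>R (v - u))) (v - u)"
    by auto
  let ?d = "grad F (u + t *\<^sub>R (v - u)) - grad F u"
  have "norm ?d \<le> t * (L * norm (v - u))"
    using lip[of "u + t *\<^sub>R (v - u)" u] t(1) by (simp add: mult_ac)
  also have "\<dots> \<le> L * norm (v - u)"
    using L t by (intro mult_left_le_one_le) auto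
  finally have "norm ?d * norm (v - u) \<le> (L * norm (v - u)) * norm (v - u)"
    by (rule mult_right_mono) simp
  hence "inner ?d (v - u) \<le> L * (norm (v - u))\<^sup>2"
    using norm_cauchy_schwarz[of ?d "v - u"] by (simp add: power2_eq_square mult.assoc)
  moreover have "F v - F u = inner (grad F u) (v - u) + inner ?d (v - u)"
    unfolding t(3) by (simp flip: inner_add_left)
  ultimately show ?thesis by simp
qed

text \<open>Used twice in \<open>expected_descent\<close>: with both fields equal to
  \<open>grad F\<close> for the squared norm, and with one of them a component gradient for the
  sampled inner product.\<close>

lemma inner_lipschitz:
  fixes a b :: "'a::real_inner \<Rightarrow> 'a"
  assumes "\<And>z. norm (a z) \<le> D" "\<And>z. norm (b z) \<le> D"
    and "\<And>u v. norm (a u - a v) \<le> L * norm (u - v)" "\<And>u v. norm (b u - b v) \<le> L * norm (u - v)"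
  shows "\<bar>inner (a u) (b u) - inner (a v) (b v)\<bar> \<le> 2 * D * L * norm (u - v)"
proof -
  have D: "D \<ge> 0" using assms(1)[of u] norm_ge_zero[of "a u"] by linarith
  have "inner (a u) (b u) - inner (a v) (b v) = inner (a u - a v) (b u) + inner (a v) (b u - b v)"
    by (simp add: inner_diff_left inner_diff_right)
  also have "\<bar>\<dots>\<bar> \<le> norm (a u - a v) * norm (b u) + norm (a v) * norm (b u - b v)"
    by (intro order_trans[OF abs_triangle_ineq] add_mono Cauchy_Schwarz_ineq2)
  also have "\<dots> \<le> (L * norm (u - v)) * D + D * (L * norm (u - v))"
    using assms D order_trans[OF norm_ge_zero assms(3)] by (intro add_mono mult_mono) auto
  finally show ?thesis by (simp add: algebra_simps)
qed

subsection \<open>Descent along the chain\<close>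

text \<open>The stepsize and noise conditions are stated from index 0 and with the logarithm of k +
  2, so that no estimate needs an exception for the initial indices.\<close>

locale inexact_mcgd_iteration = markov_chain S P M j
  for S :: "'w measure" and P :: "real mat" and M :: nat and j :: "nat \<Rightarrow> 'w \<Rightarrow> nat" +
  fixes f :: "nat \<Rightarrow> 'a::euclidean_space \<Rightarrow> real" and F :: "'a \<Rightarrow> real" and L D :: real
    and \<gamma> :: "nat \<Rightarrow> real" and e :: "nat \<Rightarrow> 'a" and x0 :: 'a and y :: "nat \<Rightarrow> 'w \<Rightarrow> 'a"
  assumes M: "M \<ge> 1"
    and diff: "\<And>i z. i < M \<Longrightarrow> f i differentiable (at z)"
    and lip: "\<And>i. i < M \<Longrightarrow> L-lipschitz_on UNIV (grad (f i))"
    and bounded: "\<And>i z. i < M \<Longrightarrow> norm (grad (f i) z) \<le> D"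
    and F: "F = (\<lambda>z. (1 / real M) * (\<Sum>i<M. f i z))"
    and min: "\<exists>xmin. \<forall>z. F xmin \<le> F z"
    and irreducible: "irreducible_matrix P"
    and aperiodic: "aperiodic_matrix P"
    and stationary: "stationary_distribution P (\<lambda>i. 1 / real M)"
    and pos: "\<And>k. \<gamma> k > 0"
    and gamma_div: "filterlim (\<lambda>n. \<Sum>k<n. \<gamma> k) at_top sequentially"
    and gamma_sq: "summable (\<lambda>k. (ln (real k + 2))\<^sup>2 * (\<gamma> k)\<^sup>2)"
    and noise: "summable (\<lambda>k. \<gamma> k * norm (e k))"
    and y: "inexact_mcgd S f \<gamma> j e x0 y"
begin

abbreviation g :: "nat \<Rightarrow> 'a \<Rightarrow> 'a" where "g i \<equiv> grad (f i)"
abbreviation \<eta> :: "nat \<Rightarrow> real" where "\<eta> k \<equiv> \<gamma> k * norm (e k)"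

lemma y_0: "\<omega> \<in> space S \<Longrightarrow> y 0 \<omega> = x0"
  and y_Suc: "\<omega> \<in> space S \<Longrightarrow> y (Suc k) \<omega> = y k \<omega> - \<gamma> k *\<^sub>R (g (j k \<omega>) (y k \<omega>) + e k)"
  using y by (auto simp: inexact_mcgd_def)

lemma L_nonneg: "L \<ge> 0"
  using lip[of 0] M lipschitz_on_nonneg by fastforce

lemma D_nonneg: "D \<ge> 0"
  using order_trans[OF norm_ge_zero bounded[of 0 0]] M by simp

lemma \<eta>_nonneg: "\<eta> k \<ge> 0"
  using pos[of k] by simp

lemma g_lipschitz: "i < M \<Longrightarrow> norm (g i u - g i v) \<le> L * norm (u - v)"
  using lipschitz_onD[OF lip, of i u v] by (simp add: dist_norm)

lemma GDERIV_F: "GDERIV F z :> (1 / real M) *\<^sub>R (\<Sum>i<M. g i z)"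
proof -
  have "((\<lambda>z. (1 / real M) * (\<Sum>i<M. f i z)) has_derivative
      (\<lambda>h. (1 / real M) * (\<Sum>i<M. inner h (g i z)))) (at z)"
    using GDERIV_grad[OF diff] unfolding gderiv_def
    by (intro has_derivative_mult_right has_derivative_sum) auto
  thus ?thesis by (simp add: F gderiv_def inner_sum_right)
qed

lemma grad_F: "grad F z = (1 / real M) *\<^sub>R (\<Sum>i<M. g i z)"
  by (rule grad_eq[OF GDERIV_F])

lemma F_differentiable: "F differentiable (at z)"
  using GDERIV_F by (auto simp: gderiv_def differentiable_def)

lemma norm_average_le:
  assumes "\<And>i. i < M \<Longrightarrow> norm (h i :: 'a) \<le> B"
  shows "norm ((1 / real M) *\<^sub>R (\<Sum>i<M. h i)) \<le> B"
proof -
  have "norm (\<Sum>i<M. h i) \<le> (\<Sum>i<M. B)" using assms by (intro sum_norm_le) auto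
  thus ?thesis using M by (simp add: field_simps)
qed

lemma grad_F_bounded: "norm (grad F z) \<le> D"
  unfolding grad_F by (rule norm_average_le) (rule bounded)

lemma grad_F_lipschitz: "norm (grad F u - grad F v) \<le> L * norm (u - v)"
proof -
  have "grad F u - grad F v = (1 / real M) *\<^sub>R (\<Sum>i<M. g i u - g i v)"
    by (simp add: grad_F sum_subtractf scaleR_diff_right)
  thus ?thesis using norm_average_le[of "\<lambda>i. g i u - g i v"] g_lipschitz by simp
qed

text \<open>The squared gradient norm as an average with uniform weights, ready for termwise
  comparison with the same average weighted by a row of a power of \<open>P\<close>.\<close>

lemma sum_inner_grad: "(\<Sum>i<M. 1 / real M * inner (grad F z) (g i z)) = (norm (grad F z))\<^sup>2"
proof -
  have "(\<Sum>i<M. 1 / real M * inner (grad F z) (g i z)) = inner (grad F z) (grad F z)"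
    by (subst (3) grad_F) (simp add: inner_sum_right sum_distrib_left)
  thus ?thesis by (simp add: power2_norm_eq_inner)
qed

text \<open>The recursion is run on a list of states instead of on \<omega>. Only entries before i
  are read, so a single \<open>Y\<close> serves all histories of length at least i.\<close>

lemma iterate_of_history:
  obtains Y where "\<And>i k \<omega>. \<omega> \<in> space S \<Longrightarrow> i \<le> k \<Longrightarrow> y i \<omega> = Y i (history j k \<omega>)"
proof -
  define Y where "Y = rec_nat (\<lambda>s. x0) (\<lambda>k z s. z s - \<gamma> k *\<^sub>R (g (s ! k) (z s) + e k))"
  have "y i \<omega> = Y i (history j k \<omega>)" if "\<omega> \<in> space S" "i \<le> k" for i k \<omega>
    using that(2)
  proof (induction i)
    case 0
    then show ?case using y_0[OF that(1)] by (simp add: Y_def)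
  next
    case (Suc i)
    hence "history j k \<omega> ! i = j i \<omega>" by (simp add: history_def)
    then show ?case using Suc y_Suc[OF that(1)] by (simp add: Y_def)
  qed
  thus ?thesis using that by blast
qed

text \<open>Cutting all times off at k expresses that \<open>Z\<close> depends only on the states up
  to k, hence on a finite history, while \<open>\<Phi>\<close> may remain arbitrary.\<close>

lemma integrable_trajectory:
  fixes \<Phi> :: "(nat \<Rightarrow> 'a) \<Rightarrow> (nat \<Rightarrow> nat) \<Rightarrow> real"
  assumes "\<And>\<omega>. \<omega> \<in> space S \<Longrightarrow> Z \<omega> = \<Phi> (\<lambda>i. y (min i k) \<omega>) (\<lambda>i. j (min i k) \<omega>)"
  shows "integrable S Z"
proof -
  obtain Y where Y: "\<And>i k \<omega>. \<omega> \<in> space S \<Longrightarrow> i \<le> k \<Longrightarrow> y i \<omega> = Y i (history j k \<omega>)"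
    using iterate_of_history by blast
  have nth: "history j (Suc k) \<omega> ! min i k = j (min i k) \<omega>" for i \<omega>
    using nth_upt[of 0 "min i k" "Suc k"] by (simp add: history_def less_Suc_eq_le del: upt_Suc)
  show ?thesis
  proof (rule integrable_history)
    fix \<omega> assume "\<omega> \<in> space S"
    thus "Z \<omega> = (\<lambda>s. \<Phi> (\<lambda>i. Y (min i k) s) (\<lambda>i. s ! min i k)) (history j (Suc k) \<omega>)"
      using assms[of \<omega>] Y[of \<omega> "min _ k" "Suc k"] by (simp add: nth)
  qed
qed

lemma integrable_iterate: "integrable S (\<lambda>\<omega>. h (y k \<omega>) :: real)"
  by (rule integrable_trajectory[where \<Phi> = "\<lambda>y j. h (y k)" and k = k]) simp

lemma integrable_iterate_state: "a \<le> k \<Longrightarrow> integrable S (\<lambda>\<omega>. h (y a \<omega>) (j k \<omega>) :: real)"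
  by (rule integrable_trajectory[where \<Phi> = "\<lambda>y j. h (y a) (j k)" and k = k]) (simp add: min_def)

lemma inner_grad_bound: "i < M \<Longrightarrow> \<bar>inner (grad F z) (g i z)\<bar> \<le> D\<^sup>2"
  using order_trans[OF Cauchy_Schwarz_ineq2 mult_mono[OF grad_F_bounded bounded[of i z]]] D_nonneg
  by (simp add: power2_eq_square)

text \<open>Given the past up to a, the state \<open>j k\<close> is distributed as row
  \<open>j a\<close> of the power k - a of \<open>P\<close>, while \<open>y a\<close> is fixed.
  Under the uniform law the inner product would average to the squared norm, so the bias is the
  distance of that row from uniform times the bound D^2 on each of the M terms.\<close>

lemma mixing_bias:
  assumes C: "\<And>n i b. i < M \<Longrightarrow> b < M \<Longrightarrow> \<bar>(P ^\<^sub>m n) $$ (i, b) - 1 / real M\<bar> \<le> C * \<rho> ^ n"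
    and ak: "a \<le> k"
  shows "expectation (\<lambda>\<omega>. (norm (grad F (y a \<omega>)))\<^sup>2) - expectation (\<lambda>\<omega>. inner (grad F (y a \<omega>)) (g (j k \<omega>) (y a \<omega>)))
    \<le> real M * (C * \<rho> ^ (k - a)) * D\<^sup>2"
proof -
  obtain Y where Y: "\<And>i k \<omega>. \<omega> \<in> space S \<Longrightarrow> i \<le> k \<Longrightarrow> y i \<omega> = Y i (history j k \<omega>)"
    using iterate_of_history by blast
  let ?n = "k - a"
  let ?G = "\<lambda>z b. inner (grad F z) (g b z)"
  let ?PG = "\<lambda>\<omega>. \<Sum>b<M. (P ^\<^sub>m ?n) $$ (j a \<omega>, b) * ?G (y a \<omega>) b"
  \<comment> \<open>The history must include time a, because \<open>j a\<close> selects the row;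
    \<open>y a\<close> itself depends only on earlier states.\<close>
  have "expectation (\<lambda>\<omega>. ?G (y a \<omega>) (j k \<omega>))
      = expectation (\<lambda>\<omega>. ?G (Y a (history j (Suc a) \<omega>)) (j (a + ?n) \<omega>))"
    using Y[of _ a "Suc a"] ak by (intro Bochner_Integration.integral_cong) auto
  also have "\<dots> = expectation (\<lambda>\<omega>. \<Sum>b<M. (P ^\<^sub>m ?n) $$ (j a \<omega>, b) * ?G (Y a (history j (Suc a) \<omega>)) b)"
    using expectation_n_steps[of "\<lambda>s. ?G (Y a s)"] .
  also have "\<dots> = expectation ?PG"
    using Y[of _ a "Suc a"] by (intro Bochner_Integration.integral_cong) auto
  finally have eq: "expectation (\<lambda>\<omega>. ?G (y a \<omega>) (j k \<omega>)) = expectation ?PG" .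
  have int: "integrable S ?PG"
    by (rule integrable_iterate_state[where h = "\<lambda>z c. \<Sum>b<M. (P ^\<^sub>m ?n) $$ (c, b) * ?G z b"]) simp
  have "expectation (\<lambda>\<omega>. (norm (grad F (y a \<omega>)))\<^sup>2) \<le> expectation (\<lambda>\<omega>. ?PG \<omega> + real M * (C * \<rho> ^ ?n) * D\<^sup>2)"
  proof (rule integral_mono)
    show "integrable S (\<lambda>\<omega>. (norm (grad F (y a \<omega>)))\<^sup>2)" by (rule integrable_iterate)
    show "integrable S (\<lambda>\<omega>. ?PG \<omega> + real M * (C * \<rho> ^ ?n) * D\<^sup>2)" using int by simp
    fix \<omega> assume \<omega>: "\<omega> \<in> space S"
    have "(norm (grad F (y a \<omega>)))\<^sup>2 - ?PG \<omega>
        = (\<Sum>b<M. (1 / real M - (P ^\<^sub>m ?n) $$ (j a \<omega>, b)) * ?G (y a \<omega>) b)"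
      unfolding sum_inner_grad[symmetric] by (simp add: left_diff_distrib sum_subtractf)
    also have "\<dots> \<le> (\<Sum>b<M. (C * \<rho> ^ ?n) * D\<^sup>2)"
    proof (rule sum_mono)
      fix b assume b: "b \<in> {..<M}"
      have "(1 / real M - (P ^\<^sub>m ?n) $$ (j a \<omega>, b)) * ?G (y a \<omega>) b
          \<le> \<bar>1 / real M - (P ^\<^sub>m ?n) $$ (j a \<omega>, b)\<bar> * \<bar>?G (y a \<omega>) b\<bar>"
        by (metis abs_ge_self abs_mult)
      also have "\<dots> \<le> (C * \<rho> ^ ?n) * D\<^sup>2"
        using C[OF state_less[OF \<omega>, of a], of b ?n] inner_grad_bound[of b "y a \<omega>"] b
        by (intro mult_mono) (auto simp: abs_minus_commute)
      finally show "(1 / real M - (P ^\<^sub>m ?n) $$ (j a \<omega>, b)) * ?G (y a \<omega>) b \<le> (C * \<rho> ^ ?n) * D\<^sup>2" .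
    qed
    finally show "(norm (grad F (y a \<omega>)))\<^sup>2 \<le> ?PG \<omega> + real M * (C * \<rho> ^ ?n) * D\<^sup>2" by simp
  qed
  also have "\<dots> = expectation ?PG + real M * (C * \<rho> ^ ?n) * D\<^sup>2"
    using int by (simp add: prob_space)
  finally show ?thesis using eq by simp
qed

lemma step_bound: "\<omega> \<in> space S \<Longrightarrow> norm (y (Suc k) \<omega> - y k \<omega>) \<le> D * \<gamma> k + \<eta> k"
proof -
  assume \<omega>: "\<omega> \<in> space S"
  have "norm (y (Suc k) \<omega> - y k \<omega>) = \<gamma> k * norm (g (j k \<omega>) (y k \<omega>) + e k)"
    using pos[of k] by (simp add: y_Suc[OF \<omega>])
  also have "\<dots> \<le> \<gamma> k * (D + norm (e k))"
    using pos[of k] bounded[OF state_less[OF \<omega>, of k], of "y k \<omega>"]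
    by (intro mult_left_mono) (auto intro: order_trans[OF norm_triangle_ineq])
  finally show ?thesis by (simp add: algebra_simps)
qed

lemma drift_bound:
  assumes "\<omega> \<in> space S" "a \<le> k"
  shows "norm (y k \<omega> - y a \<omega>) \<le> (\<Sum>i\<in>{a..<k}. D * \<gamma> i + \<eta> i)"
proof -
  have "y k \<omega> - y a \<omega> = (\<Sum>i\<in>{a..<k}. y (Suc i) \<omega> - y i \<omega>)"
    using sum_Suc_diff'[OF assms(2), of "\<lambda>i. y i \<omega>"] by simp
  thus ?thesis using step_bound[OF assms(1)] by (metis (no_types, lifting) sum_norm_le)
qed

text \<open>All estimates except the mixing bias hold along every trajectory, so expectations are
  taken only after these have been combined. The time a stays free here, since its choice matters
  only for summability of the errors.\<close>

lemma expected_descent: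
  assumes C: "\<And>n i b. i < M \<Longrightarrow> b < M \<Longrightarrow> \<bar>(P ^\<^sub>m n) $$ (i, b) - 1 / real M\<bar> \<le> C * \<rho> ^ n"
    and ak: "a \<le> k"
  shows "expectation (\<lambda>\<omega>. F (y (Suc k) \<omega>)) + \<gamma> k * expectation (\<lambda>\<omega>. (norm (grad F (y k \<omega>)))\<^sup>2)
    \<le> expectation (\<lambda>\<omega>. F (y k \<omega>)) + (4 * D * L * (\<gamma> k * (\<Sum>i\<in>{a..<k}. D * \<gamma> i + \<eta> i))
        + real M * C * D\<^sup>2 * (\<gamma> k * \<rho> ^ (k - a)) + D * \<eta> k + L * (D * \<gamma> k + \<eta> k)\<^sup>2)"
proof -
  let ?w = "\<Sum>i\<in>{a..<k}. D * \<gamma> i + \<eta> i"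
  let ?G = "\<lambda>i z. inner (grad F z) (g i z)"
  let ?N = "\<lambda>z. (norm (grad F z))\<^sup>2"
  let ?c = "4 * D * L * (\<gamma> k * ?w) + D * \<eta> k + L * (D * \<gamma> k + \<eta> k)\<^sup>2"
  have "F (y (Suc k) \<omega>) + \<gamma> k * ?N (y k \<omega>)
      \<le> F (y k \<omega>) + \<gamma> k * (?N (y a \<omega>) - ?G (j k \<omega>) (y a \<omega>)) + ?c" if \<omega>: "\<omega> \<in> space S" for \<omega>
  proof -
    let ?u = "y k \<omega>" and ?v = "y (Suc k) \<omega>" and ?z = "y a \<omega>" and ?b = "j k \<omega>"
    have b: "?b < M" by (rule state_less[OF \<omega>])
    have "F ?v \<le> F ?u + inner (grad F ?u) (?v - ?u) + L * (norm (?v - ?u))\<^sup>2"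
      by (rule descent_inequality[OF F_differentiable grad_F_lipschitz])
    moreover have "L * (norm (?v - ?u))\<^sup>2 \<le> L * (D * \<gamma> k + \<eta> k)\<^sup>2"
      using step_bound[OF \<omega>] L_nonneg by (intro mult_left_mono power_mono) auto
    moreover have "inner (grad F ?u) (?v - ?u) = - \<gamma> k * ?G ?b ?u - \<gamma> k * inner (grad F ?u) (e k)"
      by (simp add: y_Suc[OF \<omega>] inner_add_right algebra_simps)
    moreover have "- (\<gamma> k * inner (grad F ?u) (e k)) \<le> D * \<eta> k"
    proof -
      have "\<bar>inner (grad F ?u) (e k)\<bar> \<le> D * norm (e k)"
        by (rule order_trans[OF Cauchy_Schwarz_ineq2 mult_right_mono[OF grad_F_bounded]]) simp
      hence "\<gamma> k * (- inner (grad F ?u) (e k)) \<le> \<gamma> k * (D * norm (e k))"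
        using pos[of k] by (intro mult_left_mono) auto
      thus ?thesis by (simp add: mult_ac)
    qed
    \<comment> \<open>Moving from \<open>y k\<close> to \<open>y a\<close> happens twice, in the
      squared norm and in the sampled inner product. Each move costs 2DL times the drift, hence the
      factor 4.\<close>
    moreover have "\<gamma> k * ((?N ?u - ?N ?z) + (?G ?b ?z - ?G ?b ?u)) \<le> \<gamma> k * (4 * D * L * ?w)"
    proof (rule mult_left_mono)
      have w: "2 * D * L * norm (?u - ?z) \<le> 2 * D * L * ?w"
        using drift_bound[OF \<omega> ak] D_nonneg L_nonneg by (intro mult_left_mono) auto
      have "?N ?u - ?N ?z \<le> 2 * D * L * ?w"
        using inner_lipschitz[OF grad_F_bounded grad_F_bounded grad_F_lipschitz grad_F_lipschitz, of ?u ?z] w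
        by (simp add: power2_norm_eq_inner)
      moreover have "?G ?b ?z - ?G ?b ?u \<le> 2 * D * L * ?w"
        using inner_lipschitz[OF grad_F_bounded bounded[OF b] grad_F_lipschitz g_lipschitz[OF b], of ?u ?z] w
        by simp
      ultimately show "(?N ?u - ?N ?z) + (?G ?b ?z - ?G ?b ?u) \<le> 4 * D * L * ?w" by simp
    qed (use pos[of k] in simp)
    ultimately show ?thesis by (simp add: algebra_simps)
  qed
  hence "expectation (\<lambda>\<omega>. F (y (Suc k) \<omega>) + \<gamma> k * ?N (y k \<omega>))
      \<le> expectation (\<lambda>\<omega>. F (y k \<omega>) + \<gamma> k * (?N (y a \<omega>) - ?G (j k \<omega>) (y a \<omega>)) + ?c)"
    using ak by (intro integral_mono) (auto intro!: integrable_iterate integrable_iterate_state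
        Bochner_Integration.integrable_add Bochner_Integration.integrable_diff integrable_mult_right)
  also have "\<dots> = expectation (\<lambda>\<omega>. F (y k \<omega>))
      + \<gamma> k * (expectation (\<lambda>\<omega>. ?N (y a \<omega>)) - expectation (\<lambda>\<omega>. ?G (j k \<omega>) (y a \<omega>))) + ?c"
    using integrable_iterate[of F k] integrable_iterate[of ?N a] integrable_iterate_state[OF ak, of "\<lambda>z i. ?G i z"]
    by (simp add: prob_space del: distrib_left_numeral)
  also have "expectation (\<lambda>\<omega>. F (y (Suc k) \<omega>) + \<gamma> k * ?N (y k \<omega>))
      = expectation (\<lambda>\<omega>. F (y (Suc k) \<omega>)) + \<gamma> k * expectation (\<lambda>\<omega>. ?N (y k \<omega>))"
    using integrable_iterate[of F "Suc k"] integrable_iterate[of ?N k] by simp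
  finally show ?thesis
    using mult_left_mono[OF mixing_bias[OF C ak], of "\<gamma> k"] pos[of k] by (simp add: algebra_simps)
qed

section \<open>Summability of the errors in the descent inequality\<close>

lemma summable_gamma_sq: "summable (\<lambda>k. (\<gamma> k)\<^sup>2)"
proof (rule summable_comparison_test'[OF summable_mult[OF gamma_sq, of 4], of 0])
  fix k
  have "(1 / 2)\<^sup>2 \<le> (ln (real k + 2))\<^sup>2" using half_le_ln_plus2[of k] by (intro power_mono) auto
  hence "1 \<le> 4 * (ln (real k + 2))\<^sup>2" by (simp add: power2_eq_square)
  hence "1 * (\<gamma> k)\<^sup>2 \<le> 4 * (ln (real k + 2))\<^sup>2 * (\<gamma> k)\<^sup>2" by (rule mult_right_mono) simp
  thus "norm ((\<gamma> k)\<^sup>2) \<le> 4 * ((ln (real k + 2))\<^sup>2 * (\<gamma> k)\<^sup>2)" by simp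
qed

text \<open>By truncated subtraction the exponent is the minimum of k and the window length. If the
  window fits, the power is at most 1 / (k + 2); if it reaches below time 0, the power is \<rho>^k.
  Both bounds are square summable, and a product with \<gamma> is at most the sum of the two
  squares.\<close>

lemma summable_mixing_error:
  assumes \<rho>: "0 < \<rho>" "\<rho> < 1"
  shows "summable (\<lambda>k. \<gamma> k * \<rho> ^ (k - (k - window (1 / ln (1 / \<rho>)) k)))"
proof -
  let ?c = "1 / ln (1 / \<rho>)"
  have c: "?c \<ge> 0" using \<rho> by (simp add: ln_div)
  have "summable (\<lambda>k. inverse (real k ^ 2))" by (rule inverse_power_summable) simp
  hence inv_sq: "summable (\<lambda>k. (1 / (real k + 2))\<^sup>2)"
    by (drule_tac summable_ignore_initial_segment[of _ 2]) (simp add: inverse_eq_divide power_divide add_ac)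
  have "summable (\<lambda>k. (\<rho>\<^sup>2) ^ k)" using \<rho> by (intro summable_geometric) (simp add: power_less_one_iff)
  hence geo: "summable (\<lambda>k. (\<rho> ^ k)\<^sup>2)" by (simp only: power_mult[symmetric] mult.commute)
  show ?thesis
  proof (rule summable_comparison_test'[OF summable_add[OF summable_mult[OF summable_gamma_sq, of 2]
        summable_add[OF geo inv_sq]], of 0])
    fix k
    let ?J = "window ?c k"
    have am: "\<gamma> k * b \<le> (\<gamma> k)\<^sup>2 + b\<^sup>2" if "b \<ge> 0" for b
      using sum_squares_bound[of "\<gamma> k" b] mult_nonneg_nonneg[OF less_imp_le[OF pos[of k]] that] by linarith
    have "\<rho> ^ ?J = exp (real ?J * ln \<rho>)" using \<rho> by (simp add: exp_of_nat_mult)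
    also have "\<dots> \<le> exp (?c * ln (real k + 2) * ln \<rho>)"
      unfolding exp_le_cancel_iff
      using ln_less_zero[OF \<rho>] by (intro mult_right_mono_neg window_bounds(1)[OF c]) simp
    also have "?c * ln (real k + 2) * ln \<rho> = - ln (real k + 2)"
      using \<rho> ln_less_zero[OF \<rho>] by (simp add: ln_div)
    also have "exp (- ln (real k + 2)) = 1 / (real k + 2)" by (simp add: exp_minus inverse_eq_divide)
    finally have J: "\<rho> ^ ?J \<le> 1 / (real k + 2)" .
    have "\<rho> ^ (k - (k - ?J)) \<le> \<rho> ^ k + 1 / (real k + 2)"
    proof (cases "?J \<le> k")
      case True
      thus ?thesis using J \<rho> by (simp add: add_increasing)
    qed (use \<rho> in auto)
    hence "\<gamma> k * \<rho> ^ (k - (k - ?J)) \<le> \<gamma> k * \<rho> ^ k + \<gamma> k * (1 / (real k + 2))"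
      unfolding distrib_left[symmetric] using less_imp_le[OF pos[of k]] by (rule mult_left_mono)
    also have "\<dots> \<le> 2 * (\<gamma> k)\<^sup>2 + ((\<rho> ^ k)\<^sup>2 + (1 / (real k + 2))\<^sup>2)"
      using am[of "\<rho> ^ k"] am[of "1 / (real k + 2)"] \<rho> by simp
    finally show "norm (\<gamma> k * \<rho> ^ (k - (k - ?J))) \<le> 2 * (\<gamma> k)\<^sup>2 + ((\<rho> ^ k)\<^sup>2 + (1 / (real k + 2))\<^sup>2)"
      using pos[of k] \<rho> by simp
  qed
qed

text \<open>The weighted noise is summable, hence bounded by some B, so its square is at most B
  times itself.\<close>

lemma summable_step_sq: "summable (\<lambda>k. (D * \<gamma> k + \<eta> k)\<^sup>2)"
proof -
  obtain B where B: "B \<ge> 0" "\<And>k. \<bar>\<eta> k\<bar> \<le> B" using summable_bounded[OF noise] by blast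
  show ?thesis
  proof (rule summable_comparison_test'[OF summable_add[OF summable_mult[OF summable_gamma_sq, of "2 * D\<^sup>2"]
        summable_mult[OF noise, of "2 * B"]], of 0])
    fix k
    have "(\<eta> k)\<^sup>2 \<le> B * \<eta> k"
      using B(2)[of k] \<eta>_nonneg[of k] unfolding power2_eq_square by (intro mult_right_mono) auto
    moreover have "(D * \<gamma> k + \<eta> k)\<^sup>2 \<le> 2 * (D * \<gamma> k)\<^sup>2 + 2 * (\<eta> k)\<^sup>2"
      using sum_squares_bound[of "D * \<gamma> k" "\<eta> k"] by (simp add: power2_sum)
    ultimately show "norm ((D * \<gamma> k + \<eta> k)\<^sup>2) \<le> 2 * D\<^sup>2 * (\<gamma> k)\<^sup>2 + 2 * B * \<eta> k"
      by (simp add: power_mult_distrib)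
  qed
qed

text \<open>The descent inequality telescopes, and the minimum of \<open>F\<close> bounds the total
  decrease of its expectation from below.\<close>

theorem summable_expected_grad_sq: "summable (\<lambda>k. \<gamma> k * expectation (\<lambda>\<omega>. (norm (grad F (y k \<omega>)))\<^sup>2))"
proof -
  obtain C \<rho> where C: "C \<ge> 0" and \<rho>: "0 < \<rho>" "\<rho> < 1"
    and mix: "\<And>n i b. i < M \<Longrightarrow> b < M \<Longrightarrow> \<bar>(P ^\<^sub>m n) $$ (i, b) - 1 / real M\<bar> \<le> C * \<rho> ^ n"
    using geometric_mixing[OF carrier_P stochastic M irreducible aperiodic stationary] by metis
  define c where "c = 1 / ln (1 / \<rho>)"
  have c: "c \<ge> 0" using \<rho> by (simp add: c_def ln_div)
  define a where "a k = k - window c k" for k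
  define \<epsilon> where "\<epsilon> k = 4 * D * L * (\<gamma> k * (\<Sum>i\<in>{a k..<k}. D * \<gamma> i + \<eta> i))
      + real M * C * D\<^sup>2 * (\<gamma> k * \<rho> ^ (k - a k)) + D * \<eta> k + L * (D * \<gamma> k + \<eta> k)\<^sup>2" for k
  have window_terms: "summable (\<lambda>k. \<gamma> k * (\<Sum>i\<in>{a k..<k}. D * \<gamma> i + \<eta> i))"
  proof -
    have "\<gamma> k * (\<Sum>i\<in>{a k..<k}. D * \<gamma> i + \<eta> i)
        = D * (\<gamma> k * (\<Sum>i\<in>{a k..<k}. \<gamma> i)) + \<gamma> k * (\<Sum>i\<in>{a k..<k}. \<eta> i)" for k
      by (simp add: sum.distrib sum_distrib_left distrib_left mult_ac)
    thus ?thesis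
      unfolding a_def using summable_window_terms[OF c less_imp_le[OF pos] \<eta>_nonneg gamma_sq noise]
      by (simp only:) (intro summable_add summable_mult)
  qed
  have "summable (\<lambda>k. \<gamma> k * \<rho> ^ (k - a k))"
    using summable_mixing_error[OF \<rho>] by (simp add: a_def c_def)
  with window_terms have sum_\<epsilon>: "summable \<epsilon>"
    unfolding \<epsilon>_def by (intro summable_add summable_mult noise summable_step_sq)
  have \<epsilon>0: "\<epsilon> k \<ge> 0" for k
    unfolding \<epsilon>_def using D_nonneg L_nonneg C \<rho> less_imp_le[OF pos] \<eta>_nonneg
    by (intro add_nonneg_nonneg mult_nonneg_nonneg sum_nonneg) auto
  let ?E = "\<lambda>k. expectation (\<lambda>\<omega>. F (y k \<omega>))"
  let ?N = "\<lambda>k. \<gamma> k * expectation (\<lambda>\<omega>. (norm (grad F (y k \<omega>)))\<^sup>2)"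
  have step: "?E (Suc k) + ?N k \<le> ?E k + \<epsilon> k" for k
    unfolding \<epsilon>_def by (rule expected_descent[OF mix]) (auto simp: a_def)
  obtain xmin where xmin: "\<And>z. F xmin \<le> F z" using min by blast
  have E_ge: "?E n \<ge> F xmin" for n
    using integral_mono[of S "\<lambda>_. F xmin" "\<lambda>\<omega>. F (y n \<omega>)"] integrable_iterate[of F n] xmin
    by (simp add: prob_space)
  have partial: "(\<Sum>k<n. ?N k) \<le> ?E 0 - ?E n + (\<Sum>k<n. \<epsilon> k)" for n
  proof (induction n)
    case (Suc n)
    then show ?case using step[of n] by simp
  qed simp
  show ?thesis
  proof (rule summableI_nonneg_bounded)
    show "0 \<le> ?N k" for k using pos[of k] by simp
    show "(\<Sum>k<n. ?N k) \<le> ?E 0 - F xmin + (\<Sum>k. \<epsilon> k)" for n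
      using partial[of n] E_ge[of n] sum_le_suminf[OF sum_\<epsilon>, of "{..<n}"] \<epsilon>0 by force
  qed
qed

text \<open>The Lipschitz property of \<open>grad F\<close> turns the bound on the step length into
  slow variation of the expected norm, which together with the weighted summability excludes
  oscillation.\<close>

theorem expected_grad_tendsto_zero: "(\<lambda>k. expectation (\<lambda>\<omega>. norm (grad F (y k \<omega>)))) \<longlonglongrightarrow> 0"
proof -
  let ?a = "\<lambda>k. expectation (\<lambda>\<omega>. norm (grad F (y k \<omega>)))"
  let ?N = "\<lambda>k. expectation (\<lambda>\<omega>. (norm (grad F (y k \<omega>)))\<^sup>2)"
  note int = integrable_iterate[of "\<lambda>z. norm (grad F z)"]
  \<comment> \<open>Jensen's inequality for the square, in the form that a variance is
    nonnegative.\<close>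
  have sq_le: "(?a k)\<^sup>2 \<le> ?N k" for k
    using variance_positive[of "\<lambda>\<omega>. norm (grad F (y k \<omega>))"]
      variance_eq[OF int integrable_iterate[of "\<lambda>z. (norm (grad F z))\<^sup>2"]] by simp
  have step: "\<bar>?a (Suc k) - ?a k\<bar> \<le> L * D * \<gamma> k + L * \<eta> k" for k
  proof -
    have "\<bar>?a (Suc k) - ?a k\<bar> = \<bar>expectation (\<lambda>\<omega>. norm (grad F (y (Suc k) \<omega>)) - norm (grad F (y k \<omega>)))\<bar>"
      using int by simp
    also have "\<dots> \<le> expectation (\<lambda>\<omega>. \<bar>norm (grad F (y (Suc k) \<omega>)) - norm (grad F (y k \<omega>))\<bar>)"
      by (rule integral_abs_bound)
    also have "\<dots> \<le> expectation (\<lambda>\<omega>. L * (D * \<gamma> k + \<eta> k))"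
    proof (rule integral_mono)
      fix \<omega> assume \<omega>: "\<omega> \<in> space S"
      have "\<bar>norm (grad F (y (Suc k) \<omega>)) - norm (grad F (y k \<omega>))\<bar> \<le> norm (grad F (y (Suc k) \<omega>) - grad F (y k \<omega>))"
        by (rule norm_triangle_ineq3)
      also have "\<dots> \<le> L * norm (y (Suc k) \<omega> - y k \<omega>)" by (rule grad_F_lipschitz)
      also have "\<dots> \<le> L * (D * \<gamma> k + \<eta> k)" using step_bound[OF \<omega>] L_nonneg by (rule mult_left_mono)
      finally show "\<bar>norm (grad F (y (Suc k) \<omega>)) - norm (grad F (y k \<omega>))\<bar> \<le> L * (D * \<gamma> k + \<eta> k)" .
    qed (use int in auto)
    finally show ?thesis by (simp add: prob_space algebra_simps)
  qed
  have not_summable: "\<not> summable \<gamma>"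
    using gamma_div summable_LIMSEQ[of \<gamma>] not_tendsto_and_filterlim_at_infinity[OF sequentially_bot]
      filterlim_at_top_imp_at_infinity by blast
  show ?thesis
  proof (rule slowly_varying_tendsto_zero[where C = "L * D" and \<eta> = "\<lambda>k. L * \<eta> k"])
    show "?a k \<le> D" for k
      using integral_mono[of S "\<lambda>\<omega>. norm (grad F (y k \<omega>))" "\<lambda>_. D"] int grad_F_bounded by (simp add: prob_space)
    show "summable (\<lambda>k. L * \<eta> k)" using noise by (rule summable_mult)
    show "summable (\<lambda>k. \<gamma> k * (?a k)\<^sup>2)"
    proof (rule summable_comparison_test'[OF summable_expected_grad_sq, of 0])
      show "norm (\<gamma> k * (?a k)\<^sup>2) \<le> \<gamma> k * ?N k" for k
        using sq_le[of k] pos[of k] by (simp add: abs_mult mult_left_mono)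
    qed
  qed (use pos D_nonneg L_nonneg \<eta>_nonneg step summable_gamma_sq not_summable in \<open>auto simp: less_imp_le\<close>)
qed

theorem expected_min_grad_sq_rate:
  "(\<lambda>k. expectation (\<lambda>\<omega>. MIN i\<in>{1..k}. (norm (grad F (y i \<omega>)))\<^sup>2)) \<in> O(\<lambda>k. 1 / (\<Sum>i=1..k. \<gamma> i))"
proof -
  let ?N = "\<lambda>k. expectation (\<lambda>\<omega>. (norm (grad F (y k \<omega>)))\<^sup>2)"
  let ?m = "\<lambda>k \<omega>. MIN i\<in>{1..k}. (norm (grad F (y i \<omega>)))\<^sup>2"
  define B where "B = (\<Sum>k. \<gamma> k * ?N k)"
  \<comment> \<open>For k = 0 the minimum is over the empty set and unspecified, so the bound is
    claimed from k = 1 on. The constant \<open>B\<close> is the full series and does not depend on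
    k.\<close>
  have "norm (expectation (?m k)) \<le> B * norm (1 / (\<Sum>i=1..k. \<gamma> i))" if k: "k \<ge> 1" for k
  proof -
    have m_le: "?m k \<omega> \<le> (norm (grad F (y i \<omega>)))\<^sup>2" if "i \<in> {1..k}" for i \<omega>
      using that by (intro Min_le) auto
    have m0: "0 \<le> ?m k \<omega>" for \<omega> using k by (subst Min_ge_iff) auto
    have int: "integrable S (?m k)"
    proof (rule integrable_trajectory[where \<Phi> = "\<lambda>y j. MIN i\<in>{1..k}. (norm (grad F (y i)))\<^sup>2" and k = k])
      have "(\<lambda>i. (norm (grad F (y i \<omega>)))\<^sup>2) ` {1..k} = (\<lambda>i. (norm (grad F (y (min i k) \<omega>)))\<^sup>2) ` {1..k}" for \<omega>
        by (rule image_cong) auto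
      thus "?m k \<omega> = (MIN i\<in>{1..k}. (norm (grad F (y (min i k) \<omega>)))\<^sup>2)" for \<omega> by simp
    qed
    have "(\<Sum>i=1..k. \<gamma> i) > 0" using pos k by (intro sum_pos) auto
    moreover have "expectation (?m k) * (\<Sum>i=1..k. \<gamma> i) \<le> B"
    proof -
      have "expectation (?m k) * (\<Sum>i=1..k. \<gamma> i) = (\<Sum>i=1..k. \<gamma> i * expectation (?m k))"
        by (subst mult.commute) (rule sum_distrib_right)
      also have "\<dots> \<le> (\<Sum>i=1..k. \<gamma> i * ?N i)"
        using m_le less_imp_le[OF pos]
        by (intro sum_mono mult_left_mono integral_mono int integrable_iterate[of "\<lambda>z. (norm (grad F z))\<^sup>2"]) auto
      also have "\<dots> \<le> B"
        unfolding B_def using less_imp_le[OF pos]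
        by (intro sum_le_suminf summable_expected_grad_sq) auto
      finally show ?thesis .
    qed
    moreover have "expectation (?m k) \<ge> 0" using m0 by (simp add: integral_nonneg)
    ultimately show ?thesis by (simp add: field_simps)
  qed
  thus ?thesis by (intro bigoI[of _ B] eventually_sequentiallyI[of 1])
qed

end

section \<open>Power-type noise and assembly of all the claims\<close>

lemma summable_power_weighted_noise:
  fixes \<gamma> \<nu> :: "nat \<Rightarrow> real"
  assumes \<gamma>: "\<gamma> \<in> O(\<lambda>k. real k powr (- q))" and \<nu>: "\<nu> \<in> O(\<lambda>k. real k powr (- p))" and pq: "p + q > 1"
  shows "summable (\<lambda>k. \<gamma> k * \<nu> k)"
proof -
  have "(\<lambda>k. \<gamma> k * \<nu> k) \<in> O(\<lambda>k. real k powr (- q) * real k powr (- p))"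
    using \<gamma> \<nu> by (rule landau_o.big.mult)
  also have "(\<lambda>k. real k powr (- q) * real k powr (- p)) = (\<lambda>k. real k powr (- (p + q)))"
    by (simp add: powr_add[symmetric] add.commute)
  finally obtain c where "\<forall>\<^sub>F k in sequentially. norm (\<gamma> k * \<nu> k) \<le> c * norm (real k powr (- (p + q)))"
    by (elim landau_o.bigE)
  moreover have "summable (\<lambda>k. c * norm (real k powr (- (p + q))))"
    using pq by (intro summable_mult) (simp add: summable_real_powr_iff)
  ultimately show ?thesis by (rule summable_comparison_test_ev)
qed

theorem theorem2:
  fixes f :: "nat \<Rightarrow> real ^ 'd \<Rightarrow> real"
    and F :: "real ^ 'd \<Rightarrow> real"
    and M :: nat
    and L D :: real
    and S :: "'w measure"
    and P :: "real mat"
    and j :: "nat \<Rightarrow> 'w \<Rightarrow> nat"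
    and \<gamma> :: "nat \<Rightarrow> real"
    and x0 :: "real ^ 'd"
    and x :: "nat \<Rightarrow> 'w \<Rightarrow> real ^ 'd"
  assumes M: "M \<ge> 1"
    and diff: "\<And>i z. i < M \<Longrightarrow> f i differentiable (at z)"
    and lip: "\<And>i. i < M \<Longrightarrow> L-lipschitz_on UNIV (grad (f i))"
    and D: "D > 0"
    and bounded: "\<And>i z. i < M \<Longrightarrow> norm (grad (f i) z) \<le> D"
    and F: "F = (\<lambda>z. (1 / real M) * (\<Sum>i<M. f i z))"
    and min: "\<exists>xmin. \<forall>z. F xmin \<le> F z"
    and P: "P \<in> carrier_mat M M"
    and chain: "homogeneous_markov_chain S P j"
    and irreducible: "irreducible_matrix P"
    and aperiodic: "aperiodic_matrix P"
    and stationary: "stationary_distribution P (\<lambda>i. 1 / real M)"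
    and pos: "\<And>k. \<gamma> k > 0"
    and gamma_div: "filterlim (\<lambda>n. \<Sum>k<n. \<gamma> k) at_top sequentially"
    and gamma_sq: "summable (\<lambda>k. (ln (real (Suc k)))\<^sup>2 * (\<gamma> (Suc k))\<^sup>2)"
    and x: "mcgd S f \<gamma> j x0 x"
  shows
    "((\<lambda>k. \<integral>\<omega>. norm (grad F (x k \<omega>)) \<partial>S) \<longlonglongrightarrow> 0) \<and>
     ((\<lambda>k. \<integral>\<omega>. (MIN i\<in>{1..k}. (norm (grad F (x i \<omega>)))\<^sup>2) \<partial>S)
        \<in> O(\<lambda>k. psi P / (\<Sum>i=1..k. \<gamma> i))) \<and>
     (\<forall>q. 1/2 < q \<longrightarrow> q < 1 \<longrightarrow> \<gamma> \<in> \<Theta>(\<lambda>k. real k powr (- q)) \<longrightarrow>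
        (\<lambda>k. \<integral>\<omega>. (MIN i\<in>{1..k}. (norm (grad F (x i \<omega>)))\<^sup>2) \<partial>S)
          \<in> O(\<lambda>k. psi P / real k powr (1 - q))) \<and>
     (\<forall>(e :: nat \<Rightarrow> real ^ 'd) y. inexact_mcgd S f \<gamma> j e x0 y \<longrightarrow>
        (summable (\<lambda>k. \<gamma> (Suc k) * norm (e (Suc k))) \<longrightarrow>
           ((\<lambda>k. \<integral>\<omega>. norm (grad F (y k \<omega>)) \<partial>S) \<longlonglongrightarrow> 0) \<and>
           ((\<lambda>k. \<integral>\<omega>. (MIN i\<in>{1..k}. (norm (grad F (y i \<omega>)))\<^sup>2) \<partial>S)
              \<in> O(\<lambda>k. psi P / (\<Sum>i=1..k. \<gamma> i)))) \<and>
        (\<forall>p q. 1/2 < q \<longrightarrow> q < 1 \<longrightarrow> \<gamma> \<in> \<Theta>(\<lambda>k. real k powr (- q)) \<longrightarrow>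
           (\<lambda>k. norm (e k)) \<in> O(\<lambda>k. real k powr (- p)) \<longrightarrow> p + q > 1 \<longrightarrow>
           ((\<lambda>k. \<integral>\<omega>. norm (grad F (y k \<omega>)) \<partial>S) \<longlonglongrightarrow> 0) \<and>
           ((\<lambda>k. \<integral>\<omega>. (MIN i\<in>{1..k}. (norm (grad F (y i \<omega>)))\<^sup>2) \<partial>S)
              \<in> O(\<lambda>k. psi P / real k powr (1 - q)))))"
proof -
  have "psi P \<ge> 1" by (simp add: psi_def)
  hence psi: "psi P \<noteq> 0" by simp
  have noiseless: "inexact_mcgd S f \<gamma> j (\<lambda>_. 0) x0 x"
    using x by (simp add: mcgd_def inexact_mcgd_def)
  let ?min = "\<lambda>y k. \<integral>\<omega>. (MIN i\<in>{1..k}. (norm (grad F (y i \<omega>)))\<^sup>2) \<partial>S"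
  have conv: "(\<lambda>k. \<integral>\<omega>. norm (grad F (y k \<omega>)) \<partial>S) \<longlonglongrightarrow> 0"
    and rate: "?min y \<in> O(\<lambda>k. psi P / (\<Sum>i=1..k. \<gamma> i))"
    if y: "inexact_mcgd S f \<gamma> j e x0 y" and e: "summable (\<lambda>k. \<gamma> k * norm (e k))" for e y
  proof -
    interpret prob_space S using chain by (simp add: homogeneous_markov_chain_def)
    interpret inexact_mcgd_iteration S P M j f F L D \<gamma> e x0 y
      by unfold_locales
        (use assms y e summable_ln_plus2_square in \<open>auto simp: homogeneous_markov_chain_def\<close>)
    show "(\<lambda>k. \<integral>\<omega>. norm (grad F (y k \<omega>)) \<partial>S) \<longlonglongrightarrow> 0" by (rule expected_grad_tendsto_zero)
    have "?min y \<in> O(\<lambda>k. 1 / (\<Sum>i=1..k. \<gamma> i))" by (rule expected_min_grad_sq_rate)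
    also have "(\<lambda>k. 1 / (\<Sum>i=1..k. \<gamma> i)) \<in> O(\<lambda>k. psi P * (1 / (\<Sum>i=1..k. \<gamma> i)))"
      using psi by (simp del: times_divide_eq_right)
    finally show "?min y \<in> O(\<lambda>k. psi P / (\<Sum>i=1..k. \<gamma> i))" by simp
  qed
  \<comment> \<open>The lower half of the \<Theta> hypothesis gives a sum of stepsizes of order at
    least k^(1 - q), and taking reciprocals turns the general rate into the power rate. This covers
    the exact and the inexact iteration alike.\<close>
  have power_rate: "?min y \<in> O(\<lambda>k. psi P / real k powr (1 - q))"
    if r: "?min y \<in> O(\<lambda>k. psi P / (\<Sum>i=1..k. \<gamma> i))"
      and q: "1/2 < q" and \<gamma>: "\<gamma> \<in> \<Theta>(\<lambda>k. real k powr (- q))" for y q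
  proof -
    have "(\<lambda>k. \<Sum>i=1..k. \<gamma> i) \<in> \<Omega>(\<lambda>k. real k powr (1 - q))"
      using q bigthetaD2[OF \<gamma>] by (intro sum_powr_lower_bound pos) auto
    hence "(\<lambda>k. real k powr (1 - q)) \<in> O(\<lambda>k. \<Sum>i=1..k. \<gamma> i)" by (simp add: bigomega_iff_bigo)
    moreover have "\<forall>\<^sub>F k in sequentially. real k powr (1 - q) \<noteq> 0"
      using eventually_gt_at_top[of 0] by eventually_elim simp
    moreover have "\<forall>\<^sub>F k in sequentially. (\<Sum>i=1..k. \<gamma> i) \<noteq> 0"
      using eventually_ge_at_top[of 1]
    proof eventually_elim
      case (elim k)
      hence "(\<Sum>i=1..k. \<gamma> i) > 0" using pos by (intro sum_pos) auto
      thus ?case by simp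
    qed
    ultimately have "(\<lambda>k. 1 / (\<Sum>i=1..k. \<gamma> i)) \<in> O(\<lambda>k. 1 / real k powr (1 - q))"
      by (simp add: landau_o.big.inverse_flip inverse_eq_divide[symmetric] landau_o.big.inverse)
    hence "(\<lambda>k. psi P * (1 / (\<Sum>i=1..k. \<gamma> i))) \<in> O(\<lambda>k. psi P * (1 / real k powr (1 - q)))"
      by (intro landau_o.big.mult) auto
    with r show ?thesis by (auto intro: landau_o.big_trans)
  qed
  \<comment> \<open>The noise condition starts at index 1; adding the single term at 0 does not
    affect summability.\<close>
  have summable_noise: "summable (\<lambda>k. \<gamma> k * norm (e k))"
    if "summable (\<lambda>k. \<gamma> (Suc k) * norm (e (Suc k)))" for e :: "nat \<Rightarrow> real ^ 'd"
    using that summable_Suc_iff[of "\<lambda>k. \<gamma> k * norm (e k)"] by simp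
  have zero_noise: "summable (\<lambda>k. \<gamma> k * norm (0 :: real ^ 'd))" by simp
  show ?thesis
  proof (intro conjI allI impI)
    show "(\<lambda>k. \<integral>\<omega>. norm (grad F (x k \<omega>)) \<partial>S) \<longlonglongrightarrow> 0"
      and x_rate: "?min x \<in> O(\<lambda>k. psi P / (\<Sum>i=1..k. \<gamma> i))"
      using conv rate noiseless zero_noise by blast+
    show "?min x \<in> O(\<lambda>k. psi P / real k powr (1 - q))"
      if "1/2 < q" "\<gamma> \<in> \<Theta>(\<lambda>k. real k powr (- q))" for q
      using power_rate x_rate that by blast
  next
    fix e :: "nat \<Rightarrow> real ^ 'd" and y
    assume y: "inexact_mcgd S f \<gamma> j e x0 y" and e: "summable (\<lambda>k. \<gamma> (Suc k) * norm (e (Suc k)))"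
    show "(\<lambda>k. \<integral>\<omega>. norm (grad F (y k \<omega>)) \<partial>S) \<longlonglongrightarrow> 0"
      and "?min y \<in> O(\<lambda>k. psi P / (\<Sum>i=1..k. \<gamma> i))"
      using conv rate y summable_noise[OF e] by blast+
  next
    fix e :: "nat \<Rightarrow> real ^ 'd" and y p q
    assume y: "inexact_mcgd S f \<gamma> j e x0 y" and q: "1/2 < (q::real)"
      and \<gamma>: "\<gamma> \<in> \<Theta>(\<lambda>k. real k powr (- q))" and e: "(\<lambda>k. norm (e k)) \<in> O(\<lambda>k. real k powr (- p))"
      and pq: "p + q > 1"
    \<comment> \<open>Here the upper half of the \<Theta> hypothesis is used, which reduces this
      case to summable weighted noise.\<close>
    have noise: "summable (\<lambda>k. \<gamma> k * norm (e k))"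
      by (rule summable_power_weighted_noise[OF bigthetaD1[OF \<gamma>] e pq])
    show "(\<lambda>k. \<integral>\<omega>. norm (grad F (y k \<omega>)) \<partial>S) \<longlonglongrightarrow> 0" by (rule conv[OF y noise])
    show "?min y \<in> O(\<lambda>k. psi P / real k powr (1 - q))" by (rule power_rate[OF rate[OF y noise] q \<gamma>])
  qed
qed

end
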